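(* Let $\alpha,\beta\in\mathbb{C}$ be nonzero with $|\alpha|^2+|\beta|^2=1$. Let $\mathcal{M}\subsetneq H^2_{\alpha,\beta}$ be a nonzero, proper, closed $S_{\alpha,\beta}$-invariant subspace, represented as $$\mathcal{M}=\mathbb{C}f_2\oplus\mathbb{C}f_1\oplus z^3\theta H^2(\mathbb{D}),$$ where $\theta$ is an inner function with $\theta(\alpha\bar\beta)\neq0$, $g\in H^2(\mathbb{D})\ominus\theta H^2(\mathbb{D})$ satisfies $(z-\alpha\bar\beta)g(z)=\frac{\beta}{\theta(\alpha\bar\beta)}[\theta(z)-\theta(\alpha\bar\beta)]$, and $$f_1=\alpha\bar\beta f_0+\beta z^2+z^3g,\qquad f_2=f_0+z^2g-\frac{\bar\alpha\beta}{\bar\beta}\,\overline{\theta(\alpha\bar\beta)}\,(1+\|g\|^2)\,z^2\theta .$$ Set $$r=\frac{\alpha\bar\beta\,\big(1+|\alpha|^2|\theta(\alpha\bar\beta)|^2(1+\|g\|^2)\big)}{|\alpha|^2|\theta(\alpha\bar\beta)|^2(1+\|g\|^2)} .$$ Then $\mathcal{M}=[\mathcal{M}\ominus S_{\alpha,\beta}\mathcal{M}]_{S_{\alpha,\beta}}$ if and only if $|r|\ge1$.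
   Context: $H^2(\mathbb{D})$ is the Hardy space of the open unit disc with its usual norm $\|\cdot\|$. Put $f_0=\alpha+\beta z$ and $H^2_{\alpha,\beta}=\overline{\mathrm{span}}\{f_0,\ z^n: n\ge 2\}$, a closed subspace of $H^2(\mathbb{D})$. Let $P_{H^2_{\alpha,\beta}}$ be the orthogonal projection of $H^2(\mathbb{D})$ onto $H^2_{\alpha,\beta}$, $M_z$ multiplication by $z$ on $H^2(\mathbb{D})$, and $S_{\alpha,\beta}=P_{H^2_{\alpha,\beta}}M_z|_{H^2_{\alpha,\beta}}$. $\oplus$ denotes orthogonal direct sum and $\mathcal{M}\ominus\mathcal{N}$ the orthogonal complement of $\mathcal{N}$ in $\mathcal{M}$. For an operator $T$ and a subset $E$, $[E]_T$ is the closed linear span of $\{T^nh: h\in E,\ n\ge0\}$. *)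

theory Defs
  imports "HOL-Complex_Analysis.Complex_Analysis"
begin

section \<open>The Hardy space of the unit disc as a complex inner product space\<close>

text \<open>
  An element of \<open>H\<^sup>2(\<bbbD>)\<close> is a holomorphic function on the open unit disc whose Taylor coefficients
  at \<open>0\<close> are square-summable. HOL functions are total; requiring the value \<open>0\<close> off the disc makes
  equality of representatives coincide with equality on the disc.
\<close>

typedef h2 = "{f :: complex \<Rightarrow> complex. f holomorphic_on ball 0 1 \<and> (\<forall>z. z \<notin> ball 0 1 \<longrightarrow> f z = 0) \<and>
                 summable (\<lambda>n. (cmod (fps_nth (fps_expansion f 0) n))\<^sup>2)}"
  morphisms h2_eval Abs_h2
proof -
  have "fps_expansion (\<lambda>z::complex. 0) 0 = 0"
    by (intro fps_ext) (simp add: fps_expansion_def)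
  then show ?thesis by (intro exI[of _ "\<lambda>z. 0"]) auto
qed

definition h2_coeff :: "h2 \<Rightarrow> nat \<Rightarrow> complex" where
  "h2_coeff f n = fps_nth (fps_expansion (h2_eval f) 0) n"

lemma h2_eval_holomorphic: "h2_eval f holomorphic_on ball 0 1"
  and h2_eval_outside: "z \<notin> ball 0 1 \<Longrightarrow> h2_eval f z = 0"
  and h2_coeff_summable: "summable (\<lambda>n. (cmod (h2_coeff f n))\<^sup>2)"
  using h2_eval[of f] by (auto simp: h2_coeff_def)

lemma h2_eval_sums:
  assumes "z \<in> ball 0 1"
  shows "(\<lambda>n. h2_coeff f n * z ^ n) sums h2_eval f z"
  using holomorphic_power_series[OF h2_eval_holomorphic assms, of f]
  by (simp add: h2_coeff_def fps_expansion_def)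

lemma fps_expansion_of_sums:
  assumes "\<And>z::complex. z \<in> ball 0 1 \<Longrightarrow> (\<lambda>n. a n * z ^ n) sums f z"
  shows "fps_expansion f 0 = Abs_fps a"
proof -
  have conv: "fps_conv_radius (Abs_fps a) \<ge> 1"
  proof -
    have "conv_radius a \<ge> 1"
    proof (rule conv_radius_geI_ex)
      fix r :: real assume r: "0 < r" "ereal r < 1"
      then have "summable (\<lambda>n. a n * of_real r ^ n)"
        using assms[of "of_real r"] by (auto simp: sums_iff)
      then show "\<exists>z. norm z = r \<and> summable (\<lambda>n. a n * z ^ n)"
        using r by (intro exI[of _ "of_real r"]) auto
    qed
    then show ?thesis by (simp add: fps_conv_radius_def)
  qed
  have "f has_fps_expansion Abs_fps a"
    unfolding has_fps_expansion_def
  proof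
    show "0 < fps_conv_radius (Abs_fps a)"
      by (rule less_le_trans[OF _ conv]) simp
    have "eventually (\<lambda>z::complex. z \<in> ball 0 1) (nhds 0)"
      by (intro eventually_nhds_in_open) auto
    then show "\<forall>\<^sub>F z in nhds 0. eval_fps (Abs_fps a) z = f z"
      by eventually_elim (use assms in \<open>simp add: eval_fps_def sums_iff\<close>)
  qed
  then show ?thesis by (rule fps_expansion_eqI)
qed

lemma h2_of_coeffs:
  assumes a: "summable (\<lambda>n. (cmod (a n))\<^sup>2)"
    and s: "\<And>z. z \<in> ball 0 1 \<Longrightarrow> (\<lambda>n. a n * z ^ n) sums f z"
    and o: "\<And>z. z \<notin> ball 0 1 \<Longrightarrow> f z = 0"
  shows "h2_eval (Abs_h2 f) = f" and "h2_coeff (Abs_h2 f) = a"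
proof -
  have 1: "fps_expansion f 0 = Abs_fps a" by (rule fps_expansion_of_sums) (rule s)
  have 2: "f holomorphic_on ball 0 1" by (rule power_series_holomorphic[of 0 1 a]) (use s in simp)
  show 3: "h2_eval (Abs_h2 f) = f"
    by (rule Abs_h2_inverse) (use 1 2 a o in auto)
  show "h2_coeff (Abs_h2 f) = a"
    by (intro ext) (simp add: h2_coeff_def 3 1)
qed

lemma h2_eqI_coeff:
  assumes "h2_coeff f = h2_coeff g"
  shows "f = g"
proof -
  have "h2_eval f z = h2_eval g z" for z
  proof (cases "z \<in> ball 0 1")
    case True
    then show ?thesis
      using h2_eval_sums[OF True, of f] h2_eval_sums[OF True, of g] assms
      by (metis sums_unique2)
  next
    case False
    then show ?thesis by (simp add: h2_eval_outside del: mem_ball_0)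
  qed
  then show ?thesis by (simp add: h2_eval_inject[symmetric] fun_eq_iff)
qed

definition h2_scale :: "complex \<Rightarrow> h2 \<Rightarrow> h2" where
  "h2_scale c f = Abs_h2 (\<lambda>z. c * h2_eval f z)"

definition h2_inner :: "h2 \<Rightarrow> h2 \<Rightarrow> complex" where
  "h2_inner f g = (\<Sum>n. h2_coeff f n * cnj (h2_coeff g n))"

definition h2_shift :: "h2 \<Rightarrow> h2" where
  "h2_shift f = Abs_h2 (\<lambda>z. z * h2_eval f z)"

definition h2_monom :: "nat \<Rightarrow> h2" where
  "h2_monom n = Abs_h2 (\<lambda>z. if z \<in> ball 0 1 then z ^ n else 0)"

lemma square_summable_add:
  assumes "summable (\<lambda>n. (cmod (a n))\<^sup>2)" "summable (\<lambda>n. (cmod (b n))\<^sup>2)"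
  shows "summable (\<lambda>n. (cmod (a n + b n))\<^sup>2)"
proof (rule summable_comparison_test')
  show "summable (\<lambda>n. 2 * ((cmod (a n))\<^sup>2 + (cmod (b n))\<^sup>2))"
    by (intro summable_mult summable_add assms)
  fix n
  have "(cmod (a n + b n))\<^sup>2 \<le> (cmod (a n) + cmod (b n))\<^sup>2"
    by (intro power_mono norm_triangle_ineq) auto
  also have "\<dots> \<le> 2 * ((cmod (a n))\<^sup>2 + (cmod (b n))\<^sup>2)"
    using zero_le_power2[of "cmod (a n) - cmod (b n)"] unfolding power2_sum power2_diff by simp
  finally show "norm ((cmod (a n + b n))\<^sup>2) \<le> 2 * ((cmod (a n))\<^sup>2 + (cmod (b n))\<^sup>2)" by simp
qed

lemma square_summable_scale:
  "summable (\<lambda>n. (cmod (a n))\<^sup>2) \<Longrightarrow> summable (\<lambda>n. (cmod (c * a n))\<^sup>2)"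
  by (simp add: norm_mult power_mult_distrib summable_mult)

lemma h2_inner_summable: "summable (\<lambda>n. h2_coeff f n * cnj (h2_coeff g n))"
proof (rule summable_comparison_test')
  show "summable (\<lambda>n. (cmod (h2_coeff f n))\<^sup>2 + (cmod (h2_coeff g n))\<^sup>2)"
    by (intro summable_add h2_coeff_summable)
  fix n
  have "2 * (cmod (h2_coeff f n) * cmod (h2_coeff g n))
        \<le> (cmod (h2_coeff f n))\<^sup>2 + (cmod (h2_coeff g n))\<^sup>2"
    using zero_le_power2[of "cmod (h2_coeff f n) - cmod (h2_coeff g n)"]
    unfolding power2_diff by simp
  moreover have "0 \<le> cmod (h2_coeff f n) * cmod (h2_coeff g n)" by simp
  ultimately have "cmod (h2_coeff f n) * cmod (h2_coeff g n)
        \<le> (cmod (h2_coeff f n))\<^sup>2 + (cmod (h2_coeff g n))\<^sup>2"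
    by linarith
  then show "norm (h2_coeff f n * cnj (h2_coeff g n))
        \<le> (cmod (h2_coeff f n))\<^sup>2 + (cmod (h2_coeff g n))\<^sup>2"
    by (simp add: norm_mult)
qed

lemma h2_eval_scale [simp]: "h2_eval (h2_scale c f) z = c * h2_eval f z"
  and h2_coeff_scale [simp]: "h2_coeff (h2_scale c f) n = c * h2_coeff f n"
proof -
  have s: "(\<lambda>n. c * h2_coeff f n * z ^ n) sums (c * h2_eval f z)" if "z \<in> ball 0 1" for z
    using sums_mult[OF h2_eval_sums[OF that, of f], of c] by (simp add: mult.assoc)
  note * = h2_of_coeffs[of "\<lambda>n. c * h2_coeff f n" "\<lambda>z. c * h2_eval f z",
      OF square_summable_scale[OF h2_coeff_summable] s]
  show "h2_eval (h2_scale c f) z = c * h2_eval f z" "h2_coeff (h2_scale c f) n = c * h2_coeff f n"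
    using * by (simp_all add: h2_scale_def h2_eval_outside del: mem_ball_0)
qed

lemma h2_eval_monom: "h2_eval (h2_monom n) z = (if z \<in> ball 0 1 then z ^ n else 0)"
  and h2_coeff_monom: "h2_coeff (h2_monom n) k = (if k = n then 1 else 0)"
proof -
  have "summable (\<lambda>k. (cmod (if k = n then 1 else 0))\<^sup>2)"
    by (rule summable_finite[of "{n}"]) auto
  moreover have "(\<lambda>k. (if k = n then 1 else 0) * z ^ k) sums (if z \<in> ball 0 1 then z ^ n else 0)"
    if "z \<in> ball 0 1" for z :: complex
    using that sums_single[of n "\<lambda>k. z ^ k"] by (simp add: if_distrib[of "\<lambda>x. x * _"] cong: if_cong)
  ultimately have *: "h2_eval (h2_monom n) = (\<lambda>z. if z \<in> ball 0 1 then z ^ n else 0)"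
    "h2_coeff (h2_monom n) = (\<lambda>k. if k = n then 1 else 0)"
    unfolding h2_monom_def by (rule h2_of_coeffs; simp del: mem_ball_0)+
  show "h2_eval (h2_monom n) z = (if z \<in> ball 0 1 then z ^ n else 0)"
    "h2_coeff (h2_monom n) k = (if k = n then 1 else 0)"
    by (simp_all only: *)
qed

lemma h2_eval_shift [simp]: "h2_eval (h2_shift f) z = z * h2_eval f z"
  and h2_coeff_shift: "h2_coeff (h2_shift f) n = (case n of 0 \<Rightarrow> 0 | Suc m \<Rightarrow> h2_coeff f m)"
proof -
  let ?a = "\<lambda>n. case n of 0 \<Rightarrow> 0 | Suc m \<Rightarrow> h2_coeff f m"
  have "summable (\<lambda>n. (cmod (?a n))\<^sup>2)"
    by (subst summable_Suc_iff[symmetric]) (simp add: h2_coeff_summable)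
  moreover have "(\<lambda>n. ?a n * z ^ n) sums (z * h2_eval f z)" if "z \<in> ball 0 1" for z
    by (rule sums_Suc_imp)
      (use sums_mult[OF h2_eval_sums[OF that, of f], of z] in \<open>simp_all add: mult_ac\<close>)
  ultimately have *: "h2_eval (h2_shift f) = (\<lambda>z. z * h2_eval f z)" "h2_coeff (h2_shift f) = ?a"
    unfolding h2_shift_def by (rule h2_of_coeffs; simp add: h2_eval_outside del: mem_ball_0)+
  show "h2_eval (h2_shift f) z = z * h2_eval f z" "h2_coeff (h2_shift f) n = ?a n"
    by (simp_all only: *)
qed

instantiation h2 :: real_inner
begin

definition "0 = Abs_h2 (\<lambda>z. 0)"
definition "f + g = Abs_h2 (\<lambda>z. h2_eval f z + h2_eval g z)"
definition "- f = h2_scale (-1) f"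
definition "f - g = (f :: h2) + - g"
definition "r *\<^sub>R f = h2_scale (of_real r) f"
definition "inner f g = Re (h2_inner f g)"
definition "norm (f :: h2) = sqrt (\<Sum>n. (cmod (h2_coeff f n))\<^sup>2)"
definition "sgn (f :: h2) = inverse (norm f) *\<^sub>R f"
definition "dist (f :: h2) g = norm (f - g)"
definition "(uniformity :: (h2 \<times> h2) filter) = (INF e\<in>{0<..}. principal {(f, g). dist f g < e})"
definition "open (U :: h2 set) \<longleftrightarrow>
  (\<forall>f\<in>U. eventually (\<lambda>(f', g). f' = f \<longrightarrow> g \<in> U) uniformity)"

lemma h2_eval_0 [simp]: "h2_eval 0 z = 0" and h2_coeff_0 [simp]: "h2_coeff 0 n = 0"
  using h2_of_coeffs[of "\<lambda>_. 0" "\<lambda>_. 0"] by (simp_all add: zero_h2_def)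

lemma h2_eval_add [simp]: "h2_eval (f + g) z = h2_eval f z + h2_eval g z"
  and h2_coeff_add [simp]: "h2_coeff (f + g) n = h2_coeff f n + h2_coeff g n"
proof -
  have s: "(\<lambda>n. (h2_coeff f n + h2_coeff g n) * z ^ n) sums (h2_eval f z + h2_eval g z)"
    if "z \<in> ball 0 1" for z
    using sums_add[OF h2_eval_sums[OF that, of f] h2_eval_sums[OF that, of g]]
    by (simp add: distrib_right)
  note * = h2_of_coeffs[of "\<lambda>n. h2_coeff f n + h2_coeff g n" "\<lambda>z. h2_eval f z + h2_eval g z",
      OF square_summable_add[OF h2_coeff_summable h2_coeff_summable] s]
  show "h2_eval (f + g) z = h2_eval f z + h2_eval g z"
    "h2_coeff (f + g) n = h2_coeff f n + h2_coeff g n"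
    using * by (simp_all add: plus_h2_def h2_eval_outside del: mem_ball_0)
qed

lemma h2_eval_uminus [simp]: "h2_eval (- f) z = - h2_eval f z"
  and h2_coeff_uminus [simp]: "h2_coeff (- f) n = - h2_coeff f n"
  by (simp_all add: uminus_h2_def)

lemma h2_eval_diff [simp]: "h2_eval (f - g) z = h2_eval f z - h2_eval g z"
  and h2_coeff_diff [simp]: "h2_coeff (f - g) n = h2_coeff f n - h2_coeff g n"
  by (simp_all add: minus_h2_def)

lemma h2_eval_scaleR [simp]: "h2_eval (r *\<^sub>R f) z = of_real r * h2_eval f z"
  and h2_coeff_scaleR [simp]: "h2_coeff (r *\<^sub>R f) n = of_real r * h2_coeff f n"
  by (simp_all add: scaleR_h2_def)

lemma h2_inner_self: "h2_inner f f = of_real (\<Sum>n. (cmod (h2_coeff f n))\<^sup>2)"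
  unfolding h2_inner_def
  by (subst suminf_of_real[OF h2_coeff_summable]) (simp only: complex_norm_square)

lemma h2_inner_add_left: "h2_inner (f + g) h = h2_inner f h + h2_inner g h"
  unfolding h2_inner_def
  by (subst suminf_add[OF h2_inner_summable h2_inner_summable]) (simp add: distrib_right)

lemma h2_inner_scale_left: "h2_inner (h2_scale c f) g = c * h2_inner f g"
  unfolding h2_inner_def
  by (subst suminf_mult[OF h2_inner_summable, symmetric]) (simp add: mult.assoc)

lemma h2_inner_cnj: "h2_inner g f = cnj (h2_inner f g)"
proof -
  have "(\<lambda>n. cnj (h2_coeff f n * cnj (h2_coeff g n))) sums cnj (h2_inner f g)"
    unfolding sums_cnj h2_inner_def by (rule summable_sums[OF h2_inner_summable])
  then show ?thesis by (simp add: h2_inner_def sums_iff mult.commute)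
qed

instance
proof
  fix f g h :: h2 and r s :: real
  show "f + g + h = f + (g + h)" "f + g = g + f" "0 + f = f" "- f + f = 0"
    "r *\<^sub>R (f + g) = r *\<^sub>R f + r *\<^sub>R g" "(r + s) *\<^sub>R f = r *\<^sub>R f + s *\<^sub>R f"
    "r *\<^sub>R s *\<^sub>R f = (r * s) *\<^sub>R f" "1 *\<^sub>R f = f"
    by (rule h2_eqI_coeff; simp add: fun_eq_iff algebra_simps)+
  show "f - g = f + - g" by (fact minus_h2_def)
  show "dist f g = norm (f - g)" by (fact dist_h2_def)
  show "sgn f = inverse (norm f) *\<^sub>R f" by (fact sgn_h2_def)
  show "(uniformity :: (h2 \<times> h2) filter) = (INF e\<in>{0<..}. principal {(f, g). dist f g < e})"
    by (fact uniformity_h2_def)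
  show "open (U :: h2 set) \<longleftrightarrow> (\<forall>f\<in>U. eventually (\<lambda>(f', g). f' = f \<longrightarrow> g \<in> U) uniformity)" for U
    by (fact open_h2_def)
  show "inner f g = inner g f"
    unfolding inner_h2_def by (subst h2_inner_cnj) simp
  show "inner (f + g) h = inner f h + inner g h"
    by (simp add: inner_h2_def h2_inner_add_left)
  show "inner (r *\<^sub>R f) g = r * inner f g"
    by (simp add: inner_h2_def scaleR_h2_def h2_inner_scale_left)
  show "0 \<le> inner f f"
    by (simp add: inner_h2_def h2_inner_self suminf_nonneg h2_coeff_summable)
  show "inner f f = 0 \<longleftrightarrow> f = 0"
  proof
    assume "inner f f = 0"
    then have "(\<Sum>n. (cmod (h2_coeff f n))\<^sup>2) = 0" by (simp add: inner_h2_def h2_inner_self)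
    then have "\<forall>n. (cmod (h2_coeff f n))\<^sup>2 = 0"
      by (subst (asm) suminf_eq_zero_iff[OF h2_coeff_summable]) auto
    then show "f = 0" by (intro h2_eqI_coeff) auto
  qed (simp add: inner_h2_def h2_inner_self)
  show "norm f = sqrt (inner f f)"
    by (simp add: norm_h2_def inner_h2_def h2_inner_self)
qed

end

global_interpretation h2: vector_space h2_scale
  by standard (rule h2_eqI_coeff; simp add: fun_eq_iff algebra_simps)+


section \<open>Subspaces and operators\<close>

definition h2_orthogonal :: "h2 set \<Rightarrow> h2 set \<Rightarrow> bool" where
  "h2_orthogonal A B \<longleftrightarrow> (\<forall>f\<in>A. \<forall>g\<in>B. h2_inner f g = 0)"

definition h2_ominus :: "h2 set \<Rightarrow> h2 set \<Rightarrow> h2 set" (infixl \<open>\<ominus>\<^sub>H\<close> 65) where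
  "M \<ominus>\<^sub>H N = {f \<in> M. \<forall>g\<in>N. h2_inner f g = 0}"

definition is_orthogonal_sum3 :: "h2 set \<Rightarrow> h2 set \<Rightarrow> h2 set \<Rightarrow> h2 set \<Rightarrow> bool" where
  "is_orthogonal_sum3 M A B C \<longleftrightarrow>
     h2_orthogonal A B \<and> h2_orthogonal A C \<and> h2_orthogonal B C \<and>
     M = {a + b + c | a b c. a \<in> A \<and> b \<in> B \<and> c \<in> C}"

text \<open>Meaningful for closed subspaces \<open>M\<close>, where the orthogonal decomposition exists and is unique.\<close>
definition h2_proj :: "h2 set \<Rightarrow> h2 \<Rightarrow> h2" where
  "h2_proj M f = (THE g. g \<in> M \<and> (\<forall>h\<in>M. h2_inner (f - g) h = 0))"

text \<open>\<open>\<phi> H\<^sup>2(\<bbbD>)\<close>, for \<open>\<phi>\<close> given on the disc.\<close>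
definition h2_mult_range :: "(complex \<Rightarrow> complex) \<Rightarrow> h2 set" where
  "h2_mult_range \<phi> = {h. \<exists>f. \<forall>z\<in>ball 0 1. h2_eval h z = \<phi> z * h2_eval f z}"

text \<open>\<open>[E]\<^sub>T\<close>\<close>
definition h2_generated :: "(h2 \<Rightarrow> h2) \<Rightarrow> h2 set \<Rightarrow> h2 set" where
  "h2_generated T E = closure (h2.span {(T ^^ n) h | n h. h \<in> E})"

definition inner_function :: "(complex \<Rightarrow> complex) \<Rightarrow> bool" where
  "inner_function \<theta> \<longleftrightarrow>
     \<theta> holomorphic_on ball 0 1 \<and> bounded (\<theta> ` ball 0 1) \<and>
     (AE t in lebesgue_on {0..2*pi}.
        \<exists>l. ((\<lambda>r. \<theta> (of_real r * cis t)) \<longlongrightarrow> l) (at_left 1) \<and> cmod l = 1)"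

definition f0 :: "complex \<Rightarrow> complex \<Rightarrow> h2" where
  "f0 \<alpha> \<beta> = h2_scale \<alpha> (h2_monom 0) + h2_scale \<beta> (h2_monom 1)"

definition H2sub :: "complex \<Rightarrow> complex \<Rightarrow> h2 set" where
  "H2sub \<alpha> \<beta> = closure (h2.span (insert (f0 \<alpha> \<beta>) {h2_monom n | n. n \<ge> 2}))"

text \<open>\<open>S\<^bsub>\<alpha>,\<beta>\<^esub>\<close> is the restriction of this map to \<open>H2sub \<alpha> \<beta>\<close>, which it leaves invariant.\<close>
definition S_op :: "complex \<Rightarrow> complex \<Rightarrow> h2 \<Rightarrow> h2" where
  "S_op \<alpha> \<beta> f = h2_proj (H2sub \<alpha> \<beta>) (h2_shift f)"

end

theory Submission
  imports Defs
begin

text \<open>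
  Put \<open>w = \<alpha> cnj \<beta>\<close>, so that \<open>|w| < 1\<close>, let \<open>d = \<beta> / \<theta>(w)\<close>, and let \<open>c\<close> be the coefficient of \<open>z\<^sup>2 \<theta>\<close> in
  \<open>f0 + z\<^sup>2 g - f2\<close>. The compressed shift \<open>S\<close> acts on functions \<open>a f0 + z\<^sup>2 h\<close> by multiplying \<open>z\<^sup>2 h\<close> by
  \<open>z\<close> and sending \<open>f0\<close> to \<open>w f0 + \<beta> z\<^sup>2\<close> (lemma \<open>S_op_eq\<close>). Together with the equation defining \<open>g\<close> this gives
  \<open>S f2 = f1 - c z\<^sup>3 \<theta>\<close>, \<open>S f1 = w f1 + d z\<^sup>3 \<theta>\<close> and \<open>S (z\<^sup>3 \<theta> h) = z\<^sup>3 \<theta> z h\<close>.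

  Since \<open>d + w c\<close> is a positive multiple of \<open>d\<close>, the image \<open>S M\<close> is the span \<open>N\<close> of \<open>f1\<close> and
  \<open>z\<^sup>3 \<theta> H\<^sup>2\<close>, and its complement in \<open>M\<close> is the line through \<open>f2\<close> (lemma \<open>wandering_subspace\<close>). As \<open>f2\<close> is
  orthogonal to \<open>N\<close>, the question is whether \<open>S f2\<close> is cyclic for \<open>S\<close> on \<open>N\<close>. The assignment
  \<open>a f1 + z\<^sup>3 \<theta> h \<mapsto> d a + (z - w) h\<close> identifies \<open>N\<close> with \<open>H\<^sup>2\<close> and \<open>S\<close> with multiplication by \<open>z\<close>: a function
  \<open>F\<close> is hit by \<open>a = F(w) / d\<close> and \<open>h = (F - F(w)) / (z - w)\<close>. The vector \<open>S f2\<close> becomes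
  \<open>d - c (z - w) = - c (z - r)\<close>, because the number \<open>r\<close> of the theorem equals \<open>w + d / c\<close>. So the theorem
  says that \<open>z - r\<close> is cyclic for the shift exactly when \<open>|r| \<ge> 1\<close>.

  If \<open>|r| < 1\<close>, evaluation at \<open>r\<close> is a bounded functional that kills all multiples of \<open>z - r\<close>. In terms of
  \<open>N\<close> its boundedness requires \<open>h(r)\<close> to be controlled by the norm of \<open>z\<^sup>3 \<theta> h\<close> even when \<open>\<theta>(r) = 0\<close>, which
  is lemma \<open>eval_le_norm_mult\<close>. If \<open>|r| \<ge> 1\<close>, Cesaro means give explicit combinations of the functions
  \<open>z\<^sup>n (z - r)\<close> that converge to \<open>1\<close> (lemma \<open>cesaro_mean_in_closed_subspace\<close>); the estimates are
  transported to \<open>N\<close> by the boundedness of the multiplier \<open>z\<^sup>3 \<theta>\<close>, a consequence of Parseval's identity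
  on circles.
\<close>

section \<open>The geometry of the Hardy space\<close>

lemma h2_eqI:
  assumes "\<And>z. z \<in> ball 0 1 \<Longrightarrow> h2_eval f z = h2_eval g z"
  shows "f = g"
proof -
  have "h2_eval f z = h2_eval g z" for z
    using assms h2_eval_outside by (cases "z \<in> ball 0 1") metis+
  then show ?thesis by (simp add: h2_eval_inject[symmetric] fun_eq_iff)
qed

lemma h2_inner_add_right: "h2_inner f (g + h) = h2_inner f g + h2_inner f h"
  by (metis complex_cnj_add h2_inner_add_left h2_inner_cnj)

lemma h2_inner_scale_right: "h2_inner f (h2_scale c g) = cnj c * h2_inner f g"
  by (metis complex_cnj_mult h2_inner_cnj h2_inner_scale_left)

lemma h2_inner_diff_left: "h2_inner (f - g) h = h2_inner f h - h2_inner g h"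
  by (metis add_diff_cancel diff_add_cancel h2_inner_add_left)

lemma h2_norm_eq: "(norm (f::h2))\<^sup>2 = (\<Sum>n. (cmod (h2_coeff f n))\<^sup>2)"
  by (simp add: norm_h2_def suminf_nonneg h2_coeff_summable)

lemma h2_inner_self_norm: "h2_inner f f = of_real ((norm f)\<^sup>2)"
  by (simp add: h2_inner_self h2_norm_eq)

lemma norm_h2_scale [simp]: "norm (h2_scale c f) = cmod c * norm f"
proof -
  have "(norm (h2_scale c f))\<^sup>2 = (cmod c * norm f)\<^sup>2"
    by (simp add: h2_norm_eq norm_mult power_mult_distrib suminf_mult h2_coeff_summable)
  then show ?thesis by (simp add: power2_eq_iff_nonneg)
qed

lemma h2_pythagoras:
  assumes "h2_inner f g = 0"
  shows "(norm (f + g))\<^sup>2 = (norm f)\<^sup>2 + (norm g)\<^sup>2"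
proof -
  have "h2_inner g f = 0" using assms by (metis complex_cnj_zero h2_inner_cnj)
  then have "h2_inner (f + g) (f + g) = h2_inner f f + h2_inner g g"
    using assms by (simp add: h2_inner_add_left h2_inner_add_right)
  then show ?thesis
    unfolding h2_inner_self_norm by (metis of_real_add of_real_eq_iff)
qed

lemma norm_le_norm_orthogonal_add:
  assumes "h2_inner f g = 0"
  shows "norm f \<le> norm (f + g)" and "norm g \<le> norm (f + g)"
proof -
  show "norm f \<le> norm (f + g)"
    by (rule power2_le_imp_le) (simp_all add: h2_pythagoras[OF assms])
  show "norm g \<le> norm (f + g)"
    by (rule power2_le_imp_le) (simp_all add: h2_pythagoras[OF assms])
qed

lemma h2_coeff_le_norm: "cmod (h2_coeff f n) \<le> norm f"
proof -
  have "(\<Sum>k\<in>{n}. (cmod (h2_coeff f k))\<^sup>2) \<le> (\<Sum>k. (cmod (h2_coeff f k))\<^sup>2)"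
    by (intro sum_le_suminf h2_coeff_summable) auto
  then show ?thesis by (intro power2_le_imp_le[OF _ norm_ge_zero]) (simp add: h2_norm_eq)
qed

text \<open>
  The constant is not sharp; it comes from comparing the Taylor series with a geometric series.
\<close>
lemma h2_eval_le_norm:
  assumes "z \<in> ball 0 1"
  shows "cmod (h2_eval f z) \<le> norm f / (1 - cmod z)"
proof -
  have z: "cmod z < 1" using assms by simp
  have le: "cmod (h2_coeff f n * z ^ n) \<le> norm f * cmod z ^ n" for n
    by (simp add: norm_mult norm_power h2_coeff_le_norm mult_right_mono)
  have s: "(\<lambda>n. norm f * cmod z ^ n) sums (norm f * (1 / (1 - cmod z)))"
    by (intro sums_mult geometric_sums) (use z in simp)
  have "cmod (\<Sum>n. h2_coeff f n * z ^ n) \<le> (\<Sum>n. norm f * cmod z ^ n)"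
    by (rule norm_suminf_le) (use le s in \<open>auto simp: sums_iff\<close>)
  then show ?thesis
    using h2_eval_sums[OF assms, of f] s by (simp add: sums_iff)
qed

lemma bounded_linear_h2_scale: "bounded_linear (h2_scale c)"
proof (rule bounded_linear_intro[where K = "cmod c"])
  show "h2_scale c (f + g) = h2_scale c f + h2_scale c g" for f g
    by (rule h2.scale_right_distrib)
  show "h2_scale c (r *\<^sub>R f) = r *\<^sub>R h2_scale c f" for r f
    by (simp add: scaleR_h2_def mult.commute)
  show "norm (h2_scale c f) \<le> norm f * cmod c" for f
    by simp
qed

lemma bounded_linear_h2_coeff: "bounded_linear (\<lambda>f. h2_coeff f n)"
  by (rule bounded_linear_intro[where K = 1]) (auto simp: h2_coeff_le_norm scaleR_conv_of_real)

lemma h2_subspace_closure: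
  assumes "h2.subspace A"
  shows "h2.subspace (closure A)"
  unfolding h2.subspace_def
proof (intro conjI ballI allI)
  show "0 \<in> closure A"
    using h2.subspace_0[OF assms] by (rule subsetD[OF closure_subset])
next
  fix x y assume "x \<in> closure A" "y \<in> closure A"
  then obtain a b where a: "\<And>n. a n \<in> A" "a \<longlonglongrightarrow> x" and b: "\<And>n. b n \<in> A" "b \<longlonglongrightarrow> y"
    unfolding closure_sequential by blast
  show "x + y \<in> closure A"
    unfolding closure_sequential
    using h2.subspace_add[OF assms a(1) b(1)] tendsto_add[OF a(2) b(2)]
    by (intro exI[of _ "\<lambda>n. a n + b n"]) blast
next
  fix c x assume "x \<in> closure A"
  then obtain a where a: "\<And>n. a n \<in> A" "a \<longlonglongrightarrow> x"
    unfolding closure_sequential by blast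
  show "h2_scale c x \<in> closure A"
    unfolding closure_sequential
    using h2.subspace_scale[OF assms a(1)] bounded_linear.tendsto[OF bounded_linear_h2_scale a(2)]
    by (intro exI[of _ "\<lambda>n. h2_scale c (a n)"]) blast
qed

lemma h2_coeff_sum: "h2_coeff (\<Sum>i\<in>A. f i) n = (\<Sum>i\<in>A. h2_coeff (f i) n)"
  by (induction A rule: infinite_finite_induct) auto

definition h2_poly :: "nat \<Rightarrow> (nat \<Rightarrow> complex) \<Rightarrow> h2" where
  "h2_poly N a = (\<Sum>k<N. h2_scale (a k) (h2_monom k))"

lemma h2_coeff_poly: "h2_coeff (h2_poly N a) n = (if n < N then a n else 0)"
  by (simp add: h2_poly_def h2_coeff_sum h2_coeff_monom if_distrib[of "\<lambda>x. _ * x"] cong: if_cong)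

lemma norm_h2_poly: "norm (h2_poly N a) = sqrt (\<Sum>k<N. (cmod (a k))\<^sup>2)"
proof -
  have "(\<Sum>n. (cmod (h2_coeff (h2_poly N a) n))\<^sup>2) = (\<Sum>k<N. (cmod (h2_coeff (h2_poly N a) k))\<^sup>2)"
    by (rule suminf_finite) (auto simp: h2_coeff_poly)
  then show ?thesis by (simp add: norm_h2_def h2_coeff_poly)
qed

lemma h2_poly_tendsto: "(\<lambda>N. h2_poly N (h2_coeff f)) \<longlonglongrightarrow> f"
proof -
  have s: "summable (\<lambda>n. (cmod (h2_coeff f n))\<^sup>2)" by (rule h2_coeff_summable)
  have eq: "(norm (f - h2_poly N (h2_coeff f)))\<^sup>2 = (norm f)\<^sup>2 - (\<Sum>k<N. (cmod (h2_coeff f k))\<^sup>2)" for N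
  proof -
    have "(norm (f - h2_poly N (h2_coeff f)))\<^sup>2
        = (\<Sum>n. (cmod (h2_coeff (f - h2_poly N (h2_coeff f)) (n + N)))\<^sup>2)
          + (\<Sum>n<N. (cmod (h2_coeff (f - h2_poly N (h2_coeff f)) n))\<^sup>2)"
      unfolding h2_norm_eq by (rule suminf_split_initial_segment) (rule h2_coeff_summable)
    also have "\<dots> = (\<Sum>n. (cmod (h2_coeff f (n + N)))\<^sup>2)"
      by (simp add: h2_coeff_poly)
    finally show ?thesis
      by (simp add: h2_norm_eq suminf_minus_initial_segment[OF s])
  qed
  have "(\<lambda>N. (norm f)\<^sup>2 - (\<Sum>k<N. (cmod (h2_coeff f k))\<^sup>2)) \<longlonglongrightarrow> (norm f)\<^sup>2 - (norm f)\<^sup>2"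
    unfolding h2_norm_eq by (intro tendsto_diff tendsto_const summable_LIMSEQ s)
  then have "(\<lambda>N. (norm (f - h2_poly N (h2_coeff f)))\<^sup>2) \<longlonglongrightarrow> 0"
    by (simp add: eq)
  then have "(\<lambda>N. norm (f - h2_poly N (h2_coeff f))) \<longlonglongrightarrow> 0"
    using tendsto_real_sqrt by fastforce
  then have "(\<lambda>N. h2_poly N (h2_coeff f) - f) \<longlonglongrightarrow> 0"
    by (subst (asm) norm_minus_commute) (rule tendsto_norm_zero_cancel)
  then show ?thesis by (rule LIM_zero_cancel)
qed

section \<open>Bounded multipliers\<close>

text \<open>
  A bounded holomorphic function multiplies \<open>H\<^sup>2\<close> into itself because the norm is a limit of
  quadratic means over circles: by Parseval's identity the mean of \<open>|f|\<^sup>2\<close> over the circle of radius \<open>\<rho>\<close>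
  is the sum of \<open>|a\<^sub>n|\<^sup>2 \<rho>\<^sup>2\<^sup>n\<close>. That identity rests on the orthogonality of the characters \<open>cis (k t)\<close>.
\<close>
lemma has_integral_cis:
  "((\<lambda>t. cis (of_int k * t)) has_integral (if k = 0 then 2 * pi else 0)) {0..2 * pi}"
proof (cases "k = 0")
  case True
  then show ?thesis
    using has_integral_const_real[of "1::complex" 0 "2 * pi"] by (simp add: scaleR_conv_of_real)
next
  case False
  have "((\<lambda>t. cis (of_int k * t)) has_integral
      cis (of_int k * (2 * pi)) / (\<i> * of_int k) - cis (of_int k * 0) / (\<i> * of_int k)) {0..2 * pi}"
  proof (rule fundamental_theorem_of_calculus)
    fix t :: real
    have "((\<lambda>z. exp (\<i> * of_int k * z) / (\<i> * of_int k)) has_field_derivative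
        exp (\<i> * of_int k * of_real t)) (at (of_real t))"
      using False by (auto intro!: derivative_eq_intros)
    from has_vector_derivative_real_field[OF this]
    show "((\<lambda>t. cis (of_int k * t) / (\<i> * of_int k)) has_vector_derivative
        cis (of_int k * t)) (at t within {0..2 * pi})"
      by (simp add: cis_conv_exp mult.assoc)
  qed simp
  moreover have "cis (of_int k * (2 * pi)) = 1"
    using cis_multiple_2pi[of "of_int k"] by (simp add: mult.commute)
  ultimately show ?thesis using False by simp
qed

lemma circle_mean_poly:
  "((\<lambda>t. (cmod (\<Sum>n<N. a n * (of_real \<rho> * cis t) ^ n))\<^sup>2) has_integral
     2 * pi * (\<Sum>n<N. (cmod (a n) * \<rho> ^ n)\<^sup>2)) {0..2 * pi}"
proof -
  define b where "b n = a n * of_real \<rho> ^ n" for n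
  define d :: "nat \<Rightarrow> nat \<Rightarrow> int" where "d n m = int n - int m" for n m
  have eq: "of_real ((cmod (\<Sum>n<N. a n * (of_real \<rho> * cis t) ^ n))\<^sup>2)
      = (\<Sum>n<N. \<Sum>m<N. b n * cnj (b m) * cis (of_int (d n m) * t))" for t
  proof -
    have "cis (of_int (d n m) * t) = cis t ^ n * cnj (cis t ^ m)" for n m
    proof -
      have "cis (of_int (d n m) * t) = cis (real n * t) * cis (real m * (- t))"
        by (simp add: d_def cis_mult algebra_simps)
      then show ?thesis by (simp only: Complex.DeMoivre[symmetric] cis_cnj complex_cnj_power)
    qed
    then show ?thesis
      unfolding complex_norm_square cnj_sum sum_product
      by (intro sum.cong refl) (simp add: b_def power_mult_distrib mult_ac)
  qed
  have "((\<lambda>t. \<Sum>n<N. \<Sum>m<N. b n * cnj (b m) * cis (of_int (d n m) * t)) has_integral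
      (\<Sum>n<N. \<Sum>m<N. b n * cnj (b m) * (if d n m = 0 then 2 * pi else 0))) {0..2 * pi}"
    by (intro has_integral_sum finite_lessThan has_integral_mult_right has_integral_cis)
  moreover have "(\<Sum>n<N. \<Sum>m<N. b n * cnj (b m) * (if d n m = 0 then 2 * pi else 0))
      = of_real (2 * pi * (\<Sum>n<N. (cmod (a n) * \<rho> ^ n)\<^sup>2))"
  proof -
    have "(\<Sum>n<N. \<Sum>m<N. b n * cnj (b m) * (if d n m = 0 then 2 * pi else 0))
        = (\<Sum>n<N. \<Sum>m<N. if n = m then of_real (2 * pi) * (b n * cnj (b m)) else 0)"
      by (intro sum.cong refl) (auto simp: d_def)
    also have "\<dots> = (\<Sum>n<N. of_real (2 * pi) * (b n * cnj (b n)))"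
      by simp
    also have "\<dots> = of_real (2 * pi * (\<Sum>n<N. (cmod (b n))\<^sup>2))"
      by (simp only: complex_norm_square[symmetric] of_real_sum of_real_mult sum_distrib_left)
    finally show ?thesis
      by (simp add: b_def norm_mult norm_power power_mult_distrib flip: power_abs)
  qed
  ultimately have "((\<lambda>t. complex_of_real ((cmod (\<Sum>n<N. a n * (of_real \<rho> * cis t) ^ n))\<^sup>2))
      has_integral of_real (2 * pi * (\<Sum>n<N. (cmod (a n) * \<rho> ^ n)\<^sup>2))) {0..2 * pi}"
    unfolding eq by simp
  from has_integral_linear[OF this bounded_linear_Re] show ?thesis
    by (simp add: o_def)
qed

text \<open>
  The polynomial identity passes to power series by dominated convergence: on a circle of radius
  \<open>\<rho> < 1\<close> all partial sums are bounded by the constant \<open>\<Sum>n. cmod (a n) * \<rho> ^ n\<close>.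
\<close>
lemma circle_mean_power_series:
  assumes f: "\<And>z. z \<in> ball 0 1 \<Longrightarrow> (\<lambda>n. a n * z ^ n) sums f z"
    and \<rho>: "0 \<le> \<rho>" "\<rho> < 1"
  shows "summable (\<lambda>n. (cmod (a n) * \<rho> ^ n)\<^sup>2)"
    and "((\<lambda>t. (cmod (f (of_real \<rho> * cis t)))\<^sup>2) has_integral
           2 * pi * (\<Sum>n. (cmod (a n) * \<rho> ^ n)\<^sup>2)) {0..2 * pi}"
proof -
  let ?x = "\<lambda>n. cmod (a n) * \<rho> ^ n"
  define R where "R = (\<rho> + 1) / 2"
  have R: "\<rho> < R" "R < 1" "0 < R" using \<rho> by (auto simp: R_def)
  have "summable (\<lambda>n. a n * of_real R ^ n)"
    using f[of "of_real R"] R by (auto simp: sums_iff)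
  then have "summable (\<lambda>n. norm (a n * of_real \<rho> ^ n))"
    by (rule powser_insidea) (use R \<rho> in auto)
  then have sx: "summable ?x" using \<rho> by (simp add: norm_mult norm_power)
  have le: "?x n \<le> suminf ?x" for n
    using sum_le_suminf[OF sx, of "{n}"] \<rho> by auto
  show sx2: "summable (\<lambda>n. (?x n)\<^sup>2)"
  proof (rule summable_comparison_test')
    show "summable (\<lambda>n. suminf ?x * ?x n)" by (intro summable_mult sx)
    show "norm ((?x n)\<^sup>2) \<le> suminf ?x * ?x n" for n
      using le[of n] \<rho> by (simp add: power2_eq_square mult_right_mono)
  qed
  have norm_p: "cmod (\<Sum>n<N. a n * (of_real \<rho> * cis t) ^ n) \<le> suminf ?x" for N t
  proof -
    have "cmod (\<Sum>n<N. a n * (of_real \<rho> * cis t) ^ n) \<le> (\<Sum>n<N. ?x n)"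
      by (rule sum_norm_le) (use \<rho> in \<open>simp add: norm_mult norm_power\<close>)
    also have "\<dots> \<le> suminf ?x"
      by (rule sum_le_suminf[OF sx]) (use \<rho> in auto)
    finally show ?thesis .
  qed
  show "((\<lambda>t. (cmod (f (of_real \<rho> * cis t)))\<^sup>2) has_integral
           2 * pi * (\<Sum>n. (?x n)\<^sup>2)) {0..2 * pi}"
  proof (rule has_integral_dominated_convergence[OF circle_mean_poly[of a \<rho>]])
    show "(\<lambda>t. (suminf ?x)\<^sup>2) integrable_on {0..2 * pi}"
      by (rule integrable_const_ivl)
    show "\<forall>t\<in>{0..2 * pi}. norm ((cmod (\<Sum>n<N. a n * (of_real \<rho> * cis t) ^ n))\<^sup>2) \<le> (suminf ?x)\<^sup>2" for N
      using norm_p by (auto intro: power_mono)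
    show "\<forall>t\<in>{0..2 * pi}. (\<lambda>N. (cmod (\<Sum>n<N. a n * (of_real \<rho> * cis t) ^ n))\<^sup>2)
        \<longlonglongrightarrow> (cmod (f (of_real \<rho> * cis t)))\<^sup>2"
    proof
      fix t
      have "of_real \<rho> * cis t \<in> ball 0 1" using \<rho> by (simp add: norm_mult)
      from f[OF this] show "(\<lambda>N. (cmod (\<Sum>n<N. a n * (of_real \<rho> * cis t) ^ n))\<^sup>2)
        \<longlonglongrightarrow> (cmod (f (of_real \<rho> * cis t)))\<^sup>2"
        unfolding sums_def by (intro tendsto_power tendsto_norm)
    qed
    show "(\<lambda>N. 2 * pi * (\<Sum>n<N. (?x n)\<^sup>2)) \<longlonglongrightarrow> 2 * pi * (\<Sum>n. (?x n)\<^sup>2)"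
      by (intro tendsto_mult tendsto_const summable_LIMSEQ sx2)
  qed
qed

definition h2_mult :: "(complex \<Rightarrow> complex) \<Rightarrow> h2 \<Rightarrow> h2" where
  "h2_mult \<phi> h = Abs_h2 (\<lambda>z. \<phi> z * h2_eval h z)"

locale bounded_multiplier =
  fixes \<phi> :: "complex \<Rightarrow> complex" and B :: real
  assumes holomorphic: "\<phi> holomorphic_on ball 0 1"
    and bound: "\<And>z. z \<in> ball 0 1 \<Longrightarrow> cmod (\<phi> z) \<le> B"
begin

lemma B_nonneg: "0 \<le> B"
  using order_trans[OF norm_ge_zero bound[of 0]] by simp

text \<open>
  On every circle the quadratic mean of the product is at most \<open>B\<^sup>2\<close> times that of \<open>h\<close>. A finite
  partial sum of the coefficients of the product is then controlled by letting the radius tend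
  to \<open>1\<close>.
\<close>
lemma sum_coeff_mult_le:
  assumes a: "\<And>z. z \<in> ball 0 1 \<Longrightarrow> (\<lambda>n. a n * z ^ n) sums (\<phi> z * h2_eval h z)"
  shows "(\<Sum>n<N. (cmod (a n))\<^sup>2) \<le> (B * norm h)\<^sup>2"
proof -
  have "(\<Sum>n<N. (cmod (a n) * \<rho> ^ n)\<^sup>2) \<le> (B * norm h)\<^sup>2" if \<rho>: "0 \<le> \<rho>" "\<rho> < 1" for \<rho>
  proof -
    let ?m = "\<lambda>n. (cmod (h2_coeff h n) * \<rho> ^ n)\<^sup>2"
    note F = circle_mean_power_series[OF a \<rho>, simplified]
    note H = circle_mean_power_series[OF h2_eval_sums \<rho>, of h, simplified]
    have "2 * pi * (\<Sum>n. (cmod (a n) * \<rho> ^ n)\<^sup>2) \<le> B\<^sup>2 * (2 * pi * (\<Sum>n. ?m n))"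
    proof (rule has_integral_le[OF F(2) has_integral_mult_right[OF H(2)]])
      fix t
      have "of_real \<rho> * cis t \<in> ball 0 1" using \<rho> by (simp add: norm_mult)
      from bound[OF this]
      have "(cmod (\<phi> (of_real \<rho> * cis t)))\<^sup>2 \<le> B\<^sup>2" by (rule power_mono) simp
      then show "(cmod (\<phi> (of_real \<rho> * cis t) * h2_eval h (of_real \<rho> * cis t)))\<^sup>2
          \<le> B\<^sup>2 * (cmod (h2_eval h (of_real \<rho> * cis t)))\<^sup>2"
        by (simp add: norm_mult power_mult_distrib mult_right_mono)
    qed
    then have "(\<Sum>n. (cmod (a n) * \<rho> ^ n)\<^sup>2) \<le> B\<^sup>2 * (\<Sum>n. ?m n)"
      by (simp add: algebra_simps)
    also have "(\<Sum>n. ?m n) \<le> (norm h)\<^sup>2"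
      unfolding h2_norm_eq
    proof (rule suminf_le[OF _ H(1) h2_coeff_summable])
      fix n
      have "cmod (h2_coeff h n) * \<rho> ^ n \<le> cmod (h2_coeff h n) * 1"
        using \<rho> by (intro mult_left_mono power_le_one) auto
      then show "?m n \<le> (cmod (h2_coeff h n))\<^sup>2"
        using \<rho> by (intro power_mono) auto
    qed
    finally have le: "(\<Sum>n. (cmod (a n) * \<rho> ^ n)\<^sup>2) \<le> (B * norm h)\<^sup>2"
      by (simp add: power_mult_distrib mult_left_mono)
    have "(\<Sum>n<N. (cmod (a n) * \<rho> ^ n)\<^sup>2) \<le> (\<Sum>n. (cmod (a n) * \<rho> ^ n)\<^sup>2)"
      by (rule sum_le_suminf[OF F(1)]) auto
    with le show ?thesis by simp
  qed
  then have "\<forall>\<^sub>F \<rho> in at_left 1. (\<Sum>n<N. (cmod (a n) * \<rho> ^ n)\<^sup>2) \<le> (B * norm h)\<^sup>2"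
    using eventually_at_left_real[of 0 1] by (auto elim!: eventually_mono)
  moreover have "((\<lambda>\<rho>::real. \<Sum>n<N. (cmod (a n) * \<rho> ^ n)\<^sup>2)
      \<longlongrightarrow> (\<Sum>n<N. (cmod (a n) * 1 ^ n)\<^sup>2)) (at_left 1)"
    by (intro tendsto_intros)
  ultimately show ?thesis
    using tendsto_upperbound[of "\<lambda>\<rho>::real. \<Sum>n<N. (cmod (a n) * \<rho> ^ n)\<^sup>2"] by fastforce
qed

lemma eval_mult [simp]: "h2_eval (h2_mult \<phi> h) z = \<phi> z * h2_eval h z"
  and norm_mult_le: "norm (h2_mult \<phi> h) \<le> B * norm h"
proof -
  let ?f = "\<lambda>z. \<phi> z * h2_eval h z"
  define a where "a n = (deriv ^^ n) ?f 0 / fact n" for n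
  have "?f holomorphic_on ball 0 1"
    by (intro holomorphic_on_mult holomorphic h2_eval_holomorphic)
  from holomorphic_power_series[OF this]
  have a: "(\<lambda>n. a n * z ^ n) sums ?f z" if "z \<in> ball 0 1" for z
    using that by (simp add: a_def)
  note le = sum_coeff_mult_le[OF a]
  have s: "summable (\<lambda>n. (cmod (a n))\<^sup>2)"
    by (rule summableI_nonneg_bounded[OF _ le]) auto
  have e: "h2_eval (h2_mult \<phi> h) = ?f" and c: "h2_coeff (h2_mult \<phi> h) = a"
    unfolding h2_mult_def
    by (rule h2_of_coeffs[OF s a]; simp add: h2_eval_outside del: mem_ball_0)+
  show "h2_eval (h2_mult \<phi> h) z = ?f z" by (simp add: e)
  have "(norm (h2_mult \<phi> h))\<^sup>2 \<le> (B * norm h)\<^sup>2"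
    unfolding h2_norm_eq c by (rule suminf_le_const[OF s le])
  then show "norm (h2_mult \<phi> h) \<le> B * norm h"
    by (rule power2_le_imp_le) (simp add: B_nonneg)
qed

lemma mult_add: "h2_mult \<phi> (f + g) = h2_mult \<phi> f + h2_mult \<phi> g"
  and mult_scale: "h2_mult \<phi> (h2_scale c f) = h2_scale c (h2_mult \<phi> f)"
  and mult_zero: "h2_mult \<phi> 0 = 0"
  by (rule h2_eqI; simp add: algebra_simps)+

lemma mult_diff: "h2_mult \<phi> (f - g) = h2_mult \<phi> f - h2_mult \<phi> g"
  by (rule h2_eqI; simp add: algebra_simps)+

lemma mult_tendsto:
  assumes "X \<longlonglongrightarrow> f"
  shows "(\<lambda>n. h2_mult \<phi> (X n)) \<longlonglongrightarrow> h2_mult \<phi> f"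
proof -
  have "(\<lambda>n. B * norm (X n - f)) \<longlonglongrightarrow> B * 0"
    by (intro tendsto_mult tendsto_const tendsto_norm_zero LIM_zero assms)
  then have "(\<lambda>n. B * norm (X n - f)) \<longlonglongrightarrow> 0" by simp
  then have "(\<lambda>n. h2_mult \<phi> (X n) - h2_mult \<phi> f) \<longlonglongrightarrow> 0"
    by (rule Lim_null_comparison[rotated])
      (use norm_mult_le in \<open>simp flip: mult_diff\<close>)
  then show ?thesis by (rule LIM_zero_cancel)
qed

lemma mult_range_eq: "h2_mult_range \<phi> = range (h2_mult \<phi>)"
proof (intro equalityI subsetI)
  fix x assume "x \<in> h2_mult_range \<phi>"
  then obtain f where "\<forall>z\<in>ball 0 1. h2_eval x z = \<phi> z * h2_eval f z"
    unfolding h2_mult_range_def by blast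
  then have "x = h2_mult \<phi> f" by (intro h2_eqI) simp
  then show "x \<in> range (h2_mult \<phi>)" by simp
qed (auto simp: h2_mult_range_def)

text \<open>
  Although \<open>\<phi>\<close> may vanish at \<open>r\<close>, the value \<open>h r\<close> depends boundedly on the product \<open>\<phi> h\<close>: zeros of
  \<open>\<phi>\<close> are isolated, so \<open>h\<close> can be recovered by division on a small circle around \<open>r\<close>, and the
  maximum principle carries the estimate to the centre. The point \<open>w\<close> witnesses that \<open>\<phi>\<close> is not
  identically zero.
\<close>
lemma eval_le_norm_mult:
  assumes "r \<in> ball 0 1" and "w \<in> ball 0 1" and "\<phi> w \<noteq> 0"
  obtains C where "\<And>h. cmod (h2_eval h r) \<le> C * norm (h2_mult \<phi> h)"
proof -
  obtain e where e: "0 < e" "ball r e \<subseteq> ball 0 1" and nz: "\<And>z. z \<in> ball r e - {r} \<Longrightarrow> \<phi> z \<noteq> 0"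
  proof (cases "\<phi> r = 0")
    case True
    then show ?thesis
      using isolated_zeros[OF holomorphic open_ball connected_ball assms(1) True assms(2,3)] that by blast
  next
    case False
    have "isCont \<phi> r"
      using holomorphic assms(1)
      by (meson holomorphic_on_imp_continuous_on continuous_on_eq_continuous_at open_ball)
    then obtain d where d: "d > 0" "\<And>z. dist r z < d \<Longrightarrow> \<phi> z \<noteq> 0"
      using continuous_at_avoid[of r \<phi> 0] False by blast
    obtain d' where "d' > 0" "ball r d' \<subseteq> ball 0 1"
      using assms(1) open_contains_ball open_ball by blast
    then show ?thesis
      using d by (intro that[of "min d d'"]) auto
  qed
  define s where "s = e / 2"
  have s: "0 < s" "cball r s \<subseteq> ball 0 1" "\<And>z. z \<in> sphere r s \<Longrightarrow> \<phi> z \<noteq> 0"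
    using e nz by (auto simp: s_def subset_iff dist_commute)
  have cont: "continuous_on (sphere r s) \<phi>"
    using holomorphic s(2)
    by (meson continuous_on_subset holomorphic_on_imp_continuous_on order_trans sphere_cball)
  have "compact (sphere r s)" "sphere r s \<noteq> {}" using s by auto
  then have "\<exists>K. \<forall>z\<in>sphere r s. inverse ((1 - cmod z) * cmod (\<phi> z)) \<le> K"
  proof -
    have "1 - cmod z \<noteq> 0" if "z \<in> sphere r s" for z
      using s(2) that sphere_cball by fastforce
    then have "continuous_on (sphere r s) (\<lambda>z. inverse ((1 - cmod z) * cmod (\<phi> z)))"
      using s(3) by (intro continuous_intros cont) auto
    from continuous_attains_sup[OF \<open>compact (sphere r s)\<close> \<open>sphere r s \<noteq> {}\<close> this]
    show ?thesis by blast
  qed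
  then obtain K where K: "\<And>z. z \<in> sphere r s \<Longrightarrow> inverse ((1 - cmod z) * cmod (\<phi> z)) \<le> K"
    by blast
  have "cmod (h2_eval h r) \<le> K * norm (h2_mult \<phi> h)" for h
  proof (rule maximum_modulus_frontier[of "h2_eval h" "cball r s"])
    show "h2_eval h holomorphic_on interior (cball r s)"
      using h2_eval_holomorphic s(2) interior_subset by (meson holomorphic_on_subset order_trans)
    show "continuous_on (closure (cball r s)) (h2_eval h)"
      using continuous_on_subset[OF holomorphic_on_imp_continuous_on[OF h2_eval_holomorphic] s(2)]
      by simp
    show "cmod (h2_eval h z) \<le> K * norm (h2_mult \<phi> h)" if "z \<in> frontier (cball r s)" for z
    proof -
      have z: "z \<in> sphere r s" using that s by simp
      then have z1: "z \<in> ball 0 1" using s(2) by auto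
      have "cmod (\<phi> z) * cmod (h2_eval h z) \<le> norm (h2_mult \<phi> h) / (1 - cmod z)"
        using h2_eval_le_norm[OF z1, of "h2_mult \<phi> h"] by (simp add: norm_mult)
      moreover have quotient: "x \<le> inverse (q * p) * y" if "0 < p" "0 < q" "p * x \<le> y / q"
        for p q x y :: real
        using that by (simp add: field_simps)
      ultimately have "cmod (h2_eval h z) \<le> inverse ((1 - cmod z) * cmod (\<phi> z)) * norm (h2_mult \<phi> h)"
        using quotient[of "cmod (\<phi> z)" "1 - cmod z"] s(3)[OF z] z1 by simp
      also have "\<dots> \<le> K * norm (h2_mult \<phi> h)"
        by (intro mult_right_mono K z) simp
      finally show ?thesis .
    qed
  qed (use s in auto)
  then show ?thesis by (rule that)
qed

end

section \<open>Cyclicity of linear polynomials with no zero in the disc\<close>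

text \<open>
  This is the cyclicity of \<open>z - r\<close> under the shift when \<open>r\<close> lies outside the open disc. With \<open>u n\<close> in
  the role of \<open>z\<^sup>n\<close>, put \<open>s = 1/r\<close> and \<open>v k = s\<^sup>k u k\<close>. Every \<open>u 0 - v k\<close> lies in \<open>K\<close> by telescoping, hence
  so does \<open>u 0\<close> minus the mean of \<open>v 0, \<dots>, v (n - 1)\<close>. On the unit circle the single vectors \<open>v k\<close> need not
  tend to \<open>0\<close>, but their means do: the sum of \<open>n\<close> of them has norm of order \<open>\<surd>n\<close>. The hypothesis
  \<open>bessel\<close> provides this bound for the increments \<open>u (Suc j) - w u j\<close>, and \<open>|w| < 1 \<le> |r|\<close> allows it to
  be transferred to the \<open>v k\<close> themselves.
\<close>
lemma cesaro_mean_in_closed_subspace: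
  fixes u :: "nat \<Rightarrow> h2"
  assumes K: "h2.subspace K" "closed K"
    and step: "\<And>n. u (Suc n) - h2_scale r (u n) \<in> K"
    and r: "1 \<le> cmod r" and w: "cmod w < 1"
    and bessel: "\<And>b n. norm (\<Sum>j<n. h2_scale (b j) (u (Suc j) - h2_scale w (u j)))
                   \<le> B * sqrt (\<Sum>j<n. (cmod (b j))\<^sup>2)"
  shows "u 0 \<in> K"
proof -
  define s where "s = inverse r"
  have r0: "r \<noteq> 0" using r by auto
  have rs: "r * s = 1" and s1: "cmod s \<le> 1"
    using r r0 by (auto simp: s_def norm_inverse inverse_le_1_iff)
  have rw: "r - w \<noteq> 0" using r w by auto
  have spow: "(cmod (s ^ k))\<^sup>2 \<le> 1" for k
    using s1 by (simp add: norm_power power_le_one)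
  define v where "v k = h2_scale (s ^ k) (u k)" for k
  \<comment> \<open>Telescoping: v k - v (k + 1) is a multiple of u (k + 1) - r u k.\<close>
  have v_in: "u 0 - v k \<in> K" for k
  proof (induction k)
    case 0
    then show ?case using h2.subspace_0[OF K(1)] by (simp add: v_def)
  next
    case (Suc k)
    have "s ^ Suc k * r = s ^ k" using rs by (simp add: mult_ac)
    then have eq: "u 0 - v (Suc k) = (u 0 - v k) - h2_scale (s ^ Suc k) (u (Suc k) - h2_scale r (u k))"
      by (simp add: v_def h2.scale_right_diff_distrib del: power_Suc)
    show ?case
      unfolding eq by (intro h2.subspace_diff[OF K(1)] h2.subspace_scale[OF K(1)] Suc step)
  qed
  define U where "U n = (\<Sum>k<n. v k)" for n
  have mean_in: "u 0 - h2_scale (inverse (of_nat (Suc n))) (U (Suc n)) \<in> K" for n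
  proof -
    have "(\<Sum>k<m. u 0 - v k) = h2_scale (of_nat m) (u 0) - U m" for m
      by (induction m) (auto simp: U_def h2.scale_left_distrib)
    then have eq: "h2_scale (inverse (of_nat (Suc n))) (\<Sum>k<Suc n. u 0 - v k)
        = u 0 - h2_scale (inverse (of_nat (Suc n))) (U (Suc n))"
      by (simp only: h2.scale_right_diff_distrib h2.scale_scale)
        (simp del: of_nat_Suc)
    show ?thesis
      unfolding eq[symmetric] by (intro h2.subspace_scale[OF K(1)] h2.subspace_sum[OF K(1)] v_in)
  qed
  have B0: "0 \<le> B"
  proof -
    have "norm (u (Suc 0) - h2_scale w (u 0)) \<le> B"
      using bessel[where b = "\<lambda>_. 1" and n = 1] by simp
    then show ?thesis by (rule order_trans[OF norm_ge_zero])
  qed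
  \<comment> \<open>D is the fixed point of the recursion norm (u (n + 1)) \<le> |w| norm (u n) + B, enlarged by norm (u 0).\<close>
  define D where "D = norm (u 0) + B / (1 - cmod w)"
  have D: "norm (u n) \<le> D" for n
  proof (induction n)
    case 0
    then show ?case using B0 w by (simp add: D_def)
  next
    case (Suc n)
    have "norm (u (Suc n) - h2_scale w (u n)) \<le> B"
      using bessel[where b = "\<lambda>j. if j = n then 1 else 0" and n = "Suc n"]
      by (simp add: if_distrib[of "\<lambda>x. h2_scale x _"] if_distrib[of cmod] if_distrib[of "\<lambda>x. x\<^sup>2"] cong: if_cong)
    moreover have "norm (u (Suc n)) \<le> norm (u (Suc n) - h2_scale w (u n)) + cmod w * norm (u n)"
      using norm_triangle_ineq[of "u (Suc n) - h2_scale w (u n)" "h2_scale w (u n)"] by simp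
    moreover have "cmod w * norm (u n) \<le> cmod w * D"
      using Suc by (rule mult_left_mono) simp
    moreover have "B + cmod w * D \<le> D"
    proof -
      have "(1 - cmod w) * D = (1 - cmod w) * norm (u 0) + B"
        using w by (simp add: D_def distrib_left)
      then have "D - (B + cmod w * D) = (1 - cmod w) * norm (u 0)"
        by (simp add: left_diff_distrib)
      moreover have "0 \<le> (1 - cmod w) * norm (u 0)" using w by simp
      ultimately show ?thesis by linarith
    qed
    ultimately show ?case by linarith
  qed
  have v_le: "norm (v n) \<le> D" for n
  proof -
    have "cmod (s ^ n) * norm (u n) \<le> 1 * D"
      using s1 D by (intro mult_mono) (auto simp: norm_power power_le_one)
    then show ?thesis by (simp add: v_def)
  qed
  \<comment> \<open>Summation by parts, using r s = 1, expresses (r - w) U n through the increments and boundary terms.\<close>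
  have U_eq: "h2_scale (r - w) (U n)
      = (\<Sum>j<n. h2_scale (s ^ j) (u (Suc j) - h2_scale w (u j))) - h2_scale r (v n - v 0)" for n
  proof (induction n)
    case 0
    then show ?case by (simp add: U_def)
  next
    case (Suc n)
    have "r * s ^ Suc n = s ^ n" using rs by (simp add: mult_ac flip: mult.assoc)
    then have "h2_scale r (v (Suc n)) = h2_scale (s ^ n) (u (Suc n))"
      by (simp add: v_def del: power_Suc)
    moreover have "U (Suc n) = U n + v n" by (simp add: U_def)
    ultimately show ?case
      using Suc by (simp add: v_def algebra_simps)
  qed
  have U_le: "norm (U n) \<le> (B * sqrt n + cmod r * (2 * D)) / cmod (r - w)" for n
  proof -
    have "(\<Sum>j<n. (cmod (s ^ j))\<^sup>2) \<le> (\<Sum>j<n. 1)"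
      by (intro sum_mono spow)
    then have "B * sqrt (\<Sum>j<n. (cmod (s ^ j))\<^sup>2) \<le> B * sqrt n"
      by (intro mult_left_mono B0) simp
    with bessel[where b = "\<lambda>j. s ^ j" and n = n]
    have "norm (\<Sum>j<n. h2_scale (s ^ j) (u (Suc j) - h2_scale w (u j))) \<le> B * sqrt n"
      by linarith
    moreover have "norm (v n - v 0) \<le> 2 * D"
      using norm_triangle_ineq4[of "v n" "v 0"] v_le[of n] v_le[of 0] by linarith
    then have "norm (h2_scale r (v n - v 0)) \<le> cmod r * (2 * D)"
      by (simp add: mult_left_mono)
    ultimately have "norm (h2_scale (r - w) (U n)) \<le> B * sqrt n + cmod r * (2 * D)"
      unfolding U_eq by (intro order_trans[OF norm_triangle_ineq4] add_mono)
    then show ?thesis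
      using rw by (simp add: pos_le_divide_eq mult.commute)
  qed
  have "(\<lambda>n. h2_scale (inverse (of_nat (Suc n))) (U (Suc n))) \<longlonglongrightarrow> 0"
  proof (rule Lim_null_comparison)
    let ?b = "\<lambda>n::nat. (B * sqrt (1 / n) + cmod r * (2 * D) * (1 / n)) / cmod (r - w)"
    show "\<forall>\<^sub>F n in sequentially. norm (h2_scale (inverse (of_nat (Suc n))) (U (Suc n))) \<le> ?b (Suc n)"
    proof (intro always_eventually allI)
      fix n
      have "norm (h2_scale (inverse (of_nat (Suc n))) (U (Suc n))) = norm (U (Suc n)) / Suc n"
        by (simp add: norm_inverse norm_divide field_simps del: of_nat_Suc)
      also have "\<dots> \<le> (B * sqrt (Suc n) + cmod r * (2 * D)) / cmod (r - w) / Suc n"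
        by (intro divide_right_mono U_le) simp
      also have "\<dots> = (B * (sqrt (Suc n) / Suc n) + cmod r * (2 * D) * (1 / Suc n)) / cmod (r - w)"
        by (simp add: add_divide_distrib mult.commute[of "cmod (r - w)"] del: of_nat_Suc)
      also have "sqrt (Suc n) / Suc n = sqrt (1 / Suc n)"
        using real_sqrt_mult_self[of "Suc n"] real_sqrt_gt_zero[of "real (Suc n)"]
        by (simp add: real_sqrt_divide divide_eq_eq eq_divide_eq del: of_nat_Suc real_sqrt_mult_self)
      finally show "norm (h2_scale (inverse (of_nat (Suc n))) (U (Suc n))) \<le> ?b (Suc n)" .
    qed
    have "?b \<longlonglongrightarrow> (B * sqrt 0 + cmod r * (2 * D) * 0) / cmod (r - w)"
      by (intro tendsto_intros lim_1_over_n) (use rw in simp)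
    then show "(\<lambda>n. ?b (Suc n)) \<longlonglongrightarrow> 0"
      by (intro LIMSEQ_Suc) simp
  qed
  then have "(\<lambda>n. u 0 - h2_scale (inverse (of_nat (Suc n))) (U (Suc n))) \<longlonglongrightarrow> u 0 - 0"
    by (intro tendsto_diff tendsto_const)
  then show ?thesis
    using closed_sequentially[OF K(2) mean_in] by simp
qed

section \<open>Shifts extended by two vectors\<close>

lemma h2_generated_subset:
  assumes "h2.subspace M" "closed M" "\<And>x. x \<in> M \<Longrightarrow> T x \<in> M" "E \<subseteq> M"
  shows "h2_generated T E \<subseteq> M"
proof -
  have "(T ^^ n) x \<in> M" if "x \<in> M" for n x
    by (induction n) (auto simp: that assms(3))
  then have "{(T ^^ n) h | n h. h \<in> E} \<subseteq> M"
    using assms(4) by blast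
  then show ?thesis
    unfolding h2_generated_def by (intro closure_minimal h2.span_minimal assms)
qed

lemma h2_shift_zero: "h2_shift 0 = 0"
  by (rule h2_eqI) simp

text \<open>
  The space \<open>M\<close> is the range of a multiplier extended by two vectors orthogonal to it and to each
  other, and \<open>S\<close> is given there by \<open>S f2 = f1 - c \<phi>\<close>, \<open>S f1 = w f1 + d \<phi>\<close> and \<open>S (\<phi> h) = \<phi> z h\<close>. The
  determinant condition \<open>det\<close> says that \<open>S f1\<close> and \<open>S f2\<close> are independent combinations of \<open>f1\<close> and
  \<open>\<phi>\<close>, so that \<open>S\<close> maps \<open>M\<close> onto everything orthogonal to \<open>f2\<close>. The point \<open>p\<close> excludes \<open>\<phi> = 0\<close>.
\<close>
locale extended_shift = bounded_multiplier \<phi> B for \<phi> B +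
  fixes S :: "h2 \<Rightarrow> h2" and f1 f2 :: h2 and w c d p :: complex and M :: "h2 set"
  assumes M: "M = {h2_scale k f2 + h2_scale a f1 + h2_mult \<phi> h | k a h. True}"
    and closed_M: "closed M"
    and S: "\<And>k a h. S (h2_scale k f2 + h2_scale a f1 + h2_mult \<phi> h)
              = h2_scale (k + a * w) f1 + h2_mult \<phi> (h2_shift h + h2_scale (a * d - k * c) (h2_monom 0))"
    and orth: "h2_inner f2 f1 = 0" "\<And>h. h2_inner f2 (h2_mult \<phi> h) = 0"
              "\<And>h. h2_inner f1 (h2_mult \<phi> h) = 0"
    and f1: "f1 \<noteq> 0"
    and w: "cmod w < 1" and c: "c \<noteq> 0" and d: "d \<noteq> 0" and det: "d + w * c \<noteq> 0"
    and p: "p \<in> ball 0 1" "\<phi> p \<noteq> 0"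
begin

definition vec :: "complex \<Rightarrow> complex \<Rightarrow> h2 \<Rightarrow> h2" where
  "vec k a h = h2_scale k f2 + h2_scale a f1 + h2_mult \<phi> h"

lemma M_eq: "M = {vec k a h | k a h. True}"
  by (simp add: M vec_def)

lemma vec_in_M [simp]: "vec k a h \<in> M"
  unfolding M_eq by blast

lemma M_cases:
  assumes "x \<in> M"
  obtains k a h where "x = vec k a h"
  using assms unfolding M_eq by blast

lemma S_vec: "S (vec k a h) = vec 0 (k + a * w) (h2_shift h + h2_scale (a * d - k * c) (h2_monom 0))"
  by (simp add: vec_def S)

lemma vec_add: "vec k a h + vec k' a' h' = vec (k + k') (a + a') (h + h')"
  by (rule h2_eqI) (simp add: vec_def algebra_simps)

lemma vec_diff: "vec k a h - vec k' a' h' = vec (k - k') (a - a') (h - h')"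
  by (rule h2_eqI) (simp add: vec_def algebra_simps)

lemma vec_scale: "h2_scale b (vec k a h) = vec (b * k) (b * a) (h2_scale b h)"
  by (rule h2_eqI) (simp add: vec_def algebra_simps)

lemma vec_f1: "vec 0 1 0 = f1" and vec_f2: "vec 1 0 0 = f2" and vec_mult: "vec 0 0 h = h2_mult \<phi> h"
  and vec_zero: "vec 0 0 0 = 0"
  by (simp_all add: vec_def mult_zero)

lemma subspace_M: "h2.subspace M"
proof -
  have "0 \<in> M" using vec_in_M[of 0 0 0] by (simp add: vec_zero)
  then show ?thesis
    unfolding h2.subspace_def by (auto elim!: M_cases simp: vec_add vec_scale)
qed

lemma S_in_M: "x \<in> M \<Longrightarrow> S x \<in> M"
  by (auto elim!: M_cases simp: S_vec)

lemma S_linear: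
  assumes "x \<in> M" "y \<in> M"
  shows "S (x - h2_scale b y) = S x - h2_scale b (S y)" and "S (h2_scale b x) = h2_scale b (S x)"
proof -
  have cong: "vec k a h = vec k' a' h'" if "k = k'" "a = a'" "h = h'" for k k' a a' h h'
    using that by simp
  obtain k a h where x: "x = vec k a h" using assms(1) by (rule M_cases)
  obtain k' a' h' where y: "y = vec k' a' h'" using assms(2) by (rule M_cases)
  show "S (x - h2_scale b y) = S x - h2_scale b (S y)"
    unfolding x y vec_scale vec_diff S_vec
    by (rule cong) (simp_all add: algebra_simps, rule h2_eqI, simp add: algebra_simps)
  show "S (h2_scale b x) = h2_scale b (S x)"
    unfolding x vec_scale S_vec
    by (rule cong) (simp_all add: algebra_simps, rule h2_eqI, simp add: algebra_simps)
qed

text \<open>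
  The two coefficients in front of \<open>f1\<close> and \<open>\<phi>\<close> are reached by solving a linear system with
  determinant \<open>d + w c\<close>; the remaining part of \<open>h\<close> is divisible by \<open>z\<close>.
\<close>
lemma vec_in_image: "vec 0 a h \<in> S ` M"
proof -
  let ?D = "d + w * c"
  let ?b = "h2_coeff h 0"
  \<comment> \<open>The backward shift of h is built from its Taylor coefficients.\<close>
  obtain h' where h': "h = h2_shift h' + h2_scale ?b (h2_monom 0)"
  proof -
    let ?a = "\<lambda>n. h2_coeff h (Suc n)"
    define f where "f z = (if z \<in> ball 0 1 then (\<Sum>n. ?a n * z ^ n) else 0)" for z
    have sums: "(\<lambda>n. ?a n * z ^ n) sums f z" if z: "z \<in> ball 0 1" for z
    proof (cases "z = 0")
      case True
      then show ?thesis by (simp add: f_def powser_zero)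
    next
      case False
      have "summable (\<lambda>n. h2_coeff h (Suc n) * z ^ Suc n)"
        using h2_eval_sums[OF z, of h]
        by (intro summable_Suc_iff[of "\<lambda>n. h2_coeff h n * z ^ n", THEN iffD2]) (simp add: sums_iff)
      then have "summable (\<lambda>n. inverse z * (h2_coeff h (Suc n) * z ^ Suc n))"
        by (rule summable_mult)
      then have "summable (\<lambda>n. ?a n * z ^ n)"
        using False by (simp add: mult_ac)
      then show ?thesis using z by (simp add: f_def summable_sums)
    qed
    have "summable (\<lambda>n. (cmod (?a n))\<^sup>2)"
      using h2_coeff_summable[of h] by (rule summable_Suc_iff[THEN iffD2])
    then have "h2_coeff (Abs_h2 f) = ?a"
      by (rule h2_of_coeffs(2)[OF _ sums]) (simp_all add: f_def)
    then have "h2_coeff h n = h2_coeff (h2_shift (Abs_h2 f) + h2_scale ?b (h2_monom 0)) n" for n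
      by (cases n) (auto simp: h2_coeff_shift h2_coeff_monom)
    then show ?thesis by (intro that h2_eqI_coeff ext)
  qed
  \<comment> \<open>Cramer's rule for k + a' w = a and a' d - k c = h(0).\<close>
  let ?a = "(a * c + ?b) / ?D" and ?k = "(a * d - w * ?b) / ?D"
  have "?k + ?a * w = a * (d + w * c) / ?D"
    by (simp add: add_divide_distrib[symmetric] diff_divide_distrib[symmetric] algebra_simps)
  then have 1: "?k + ?a * w = a" using det by simp
  have "?a * d - ?k * c = ?b * (d + w * c) / ?D"
    by (simp add: add_divide_distrib[symmetric] diff_divide_distrib[symmetric] algebra_simps)
  then have 2: "?a * d - ?k * c = ?b" using det by simp
  have "S (vec ?k ?a h') = vec 0 a h"
    unfolding S_vec 1 2 using h' by simp
  then show ?thesis by (metis imageI vec_in_M)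
qed

text \<open>
  The image of \<open>S\<close> is the span of \<open>f1\<close> and the range of the multiplier, so its complement in \<open>M\<close> is
  spanned by \<open>f2\<close>.
\<close>
lemma wandering_subspace: "M \<ominus>\<^sub>H S ` M = range (\<lambda>k. vec k 0 0)"
proof (intro equalityI subsetI)
  fix x assume "x \<in> M \<ominus>\<^sub>H S ` M"
  then have x: "x \<in> M" "\<And>y. y \<in> S ` M \<Longrightarrow> h2_inner x y = 0"
    by (auto simp: h2_ominus_def)
  from x(1) obtain k a h where x_eq: "x = vec k a h" by (rule M_cases)
  let ?y = "vec 0 a h"
  have split: "x = vec k 0 0 + ?y" by (simp add: x_eq vec_add)
  have "h2_inner (vec k 0 0) ?y = 0"
    by (simp add: vec_def mult_zero h2_inner_scale_left h2_inner_scale_right h2_inner_add_right orth)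
  moreover have "h2_inner x ?y = 0" by (rule x(2)) (rule vec_in_image)
  ultimately have "h2_inner ?y ?y = 0" by (simp add: split h2_inner_add_left)
  then have "?y = 0" by (simp add: h2_inner_self_norm)
  then show "x \<in> range (\<lambda>k. vec k 0 0)" using split by simp
next
  fix x assume "x \<in> range (\<lambda>k. vec k 0 0)"
  then obtain k where x: "x = vec k 0 0" by blast
  have "h2_inner x y = 0" if y_in: "y \<in> S ` M" for y
  proof -
    from y_in obtain y' where "y' \<in> M" and y: "y = S y'" by blast
    from this(1) obtain k' a' h' where "y' = vec k' a' h'" by (rule M_cases)
    then obtain a h where "y = vec 0 a h" using y S_vec by blast
    then show ?thesis
      by (simp add: x vec_def mult_zero h2_inner_scale_left h2_inner_scale_right
          h2_inner_add_right orth)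
  qed
  then show "x \<in> M \<ominus>\<^sub>H S ` M" by (simp add: h2_ominus_def x)
qed

lemma generated_subset: "h2_generated S (M \<ominus>\<^sub>H S ` M) \<subseteq> M"
  by (rule h2_generated_subset[OF subspace_M closed_M S_in_M]) (auto simp: h2_ominus_def)

text \<open>
  Let \<open>u n\<close> be the vectors corresponding to \<open>z\<^sup>n\<close> in the model \<open>a f1 + \<phi> h \<mapsto> d a + (z - w) h\<close>, which turns
  \<open>S\<close> into multiplication by \<open>z\<close>. The vectors \<open>S\<^sup>n\<^sup>+\<^sup>1 f2\<close> are multiples of \<open>u (n + 1) - r u n\<close>, because \<open>S f2\<close>
  corresponds to \<open>d - c (z - w) = - c (z - r)\<close>. The Cesaro argument then puts all \<open>u n\<close>, and with them
  \<open>f1\<close> and all \<open>\<phi> z\<^sup>n\<close>, into the generated subspace.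
\<close>
lemma generated_eq_if:
  assumes r: "1 \<le> cmod (w + d / c)"
  shows "M = h2_generated S (M \<ominus>\<^sub>H S ` M)"
proof
  define r where "r = w + d / c"
  define K where "K = h2_generated S (M \<ominus>\<^sub>H S ` M)"
  have K: "h2.subspace K" "closed K"
    by (simp_all add: K_def h2_generated_def h2_subspace_closure)
  have iter: "(S ^^ n) f2 \<in> K" for n
  proof -
    have "f2 \<in> M \<ominus>\<^sub>H S ` M"
      unfolding wandering_subspace by (rule image_eqI[of _ _ 1]) (simp_all add: vec_f2)
    then have "(S ^^ n) f2 \<in> h2.span {(S ^^ n) h | n h. h \<in> M \<ominus>\<^sub>H S ` M}"
      by (intro h2.span_base) blast
    then show ?thesis
      unfolding K_def h2_generated_def by (rule subsetD[OF closure_subset])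
  qed
  \<comment> \<open>The constant function 1 has the coordinates a = 1/d and h = 0.\<close>
  define u where "u n = (S ^^ n) (vec 0 (inverse d) 0)" for n
  have u_Suc: "u (Suc n) = S (u n)" and u_M: "u n \<in> M" for n
    by (simp add: u_def) (induction n, simp_all add: u_def S_in_M)
  have u1: "u (Suc 0) - h2_scale w (u 0) = h2_mult \<phi> (h2_monom 0)"
    by (rule h2_eqI) (simp add: u_def S_vec, simp add: vec_def d algebra_simps)
  have diff: "u (Suc n) - h2_scale w (u n) = h2_mult \<phi> (h2_monom n)" for n
  proof (induction n)
    case 0
    show ?case by (rule u1)
  next
    case (Suc n)
    have "u (Suc (Suc n)) - h2_scale w (u (Suc n)) = S (u (Suc n) - h2_scale w (u n))"
      by (simp only: u_Suc S_linear(1) u_M S_in_M)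
    also have "\<dots> = S (vec 0 0 (h2_monom n))" by (simp only: Suc vec_mult)
    also have "\<dots> = h2_mult \<phi> (h2_shift (h2_monom n))"
      unfolding S_vec by (simp add: vec_mult)
    also have "h2_shift (h2_monom n) = h2_monom (Suc n)"
      by (rule h2_eqI) (simp add: h2_eval_monom)
    finally show ?case .
  qed
  have S_iter: "(S ^^ Suc n) f2 = h2_scale (- c) (u (Suc n) - h2_scale r (u n))" for n
  proof (induction n)
    case 0
    have "u (Suc 0) - h2_scale r (u 0) = h2_mult \<phi> (h2_monom 0) - h2_scale (d / c) (u 0)"
      unfolding u1[symmetric] by (simp add: r_def h2.scale_left_distrib)
    also have "h2_scale (- c) \<dots> = vec 0 1 (h2_scale (- c) (h2_monom 0))"
      by (rule h2_eqI) (simp add: u_def vec_def c d field_simps)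
    finally show ?case
      using S_vec[of 1 0 0] by (simp add: vec_f2 h2_shift_zero)
  next
    case (Suc n)
    have "(S ^^ Suc (Suc n)) f2 = S (h2_scale (- c) (u (Suc n) - h2_scale r (u n)))"
      using Suc by simp
    also have "\<dots> = h2_scale (- c) (S (u (Suc n) - h2_scale r (u n)))"
      by (intro S_linear(2)[OF _ u_M[of 0]] h2.subspace_diff[OF subspace_M]
          h2.subspace_scale[OF subspace_M] u_M)
    also have "S (u (Suc n) - h2_scale r (u n)) = u (Suc (Suc n)) - h2_scale r (u (Suc n))"
      by (simp only: u_Suc S_linear(1) u_M S_in_M)
    finally show ?case .
  qed
  have step: "u (Suc n) - h2_scale r (u n) \<in> K" for n
  proof -
    have eq: "u (Suc n) - h2_scale r (u n) = h2_scale (inverse (- c)) ((S ^^ Suc n) f2)"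
      unfolding S_iter using c by (simp only: h2.scale_scale) simp
    show ?thesis unfolding eq by (rule h2.subspace_scale[OF K(1) iter])
  qed
  have mult_sum: "(\<Sum>j<n. h2_scale (b j) (h2_mult \<phi> (h2_monom j))) = h2_mult \<phi> (h2_poly n b)" for b n
    by (induction n) (simp_all add: h2_poly_def mult_zero mult_add mult_scale)
  have u0: "u 0 \<in> K"
  proof (rule cesaro_mean_in_closed_subspace[where u = u and r = r and w = w, OF K step])
    show "1 \<le> cmod r" "cmod w < 1" using r w by (simp_all add: r_def)
    show "norm (\<Sum>j<n. h2_scale (b j) (u (Suc j) - h2_scale w (u j)))
        \<le> B * sqrt (\<Sum>j<n. (cmod (b j))\<^sup>2)" for b n
      unfolding diff mult_sum using norm_mult_le[of "h2_poly n b"] by (simp add: norm_h2_poly)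
  qed
  have u_K: "u n \<in> K" for n
  proof (induction n)
    case (Suc n)
    show ?case using h2.subspace_add[OF K(1) step[of n] h2.subspace_scale[OF K(1) Suc, of r]] by simp
  qed (rule u0)
  have monom: "h2_mult \<phi> (h2_monom n) \<in> K" for n
    unfolding diff[symmetric] by (intro h2.subspace_diff[OF K(1)] h2.subspace_scale[OF K(1)] u_K)
  have mult_K: "h2_mult \<phi> h \<in> K" for h
  proof (rule closed_sequentially[OF K(2)])
    show "(\<lambda>N. h2_mult \<phi> (h2_poly N (h2_coeff h))) \<longlonglongrightarrow> h2_mult \<phi> h"
      by (rule mult_tendsto) (rule h2_poly_tendsto)
    show "h2_mult \<phi> (h2_poly N (h2_coeff h)) \<in> K" for N
      unfolding mult_sum[symmetric]
      by (intro h2.subspace_sum[OF K(1)] h2.subspace_scale[OF K(1)] monom)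
  qed
  have eq: "h2_scale d (u 0) = f1"
    by (rule h2_eqI) (simp add: u_def vec_def d)
  have "f1 \<in> K" unfolding eq[symmetric] by (rule h2.subspace_scale[OF K(1) u0])
  moreover have "f2 \<in> K" using iter[of 0] by simp
  ultimately show "M \<subseteq> h2_generated S (M \<ominus>\<^sub>H S ` M)"
    unfolding K_def[symmetric]
    by (auto elim!: M_cases simp: vec_def intro!: h2.subspace_add[OF K(1)] h2.subspace_scale[OF K(1)] mult_K)
qed (rule generated_subset)

text \<open>
  In the model \<open>a f1 + \<phi> h \<mapsto> d a + (z - w) h\<close> the vector \<open>S f2\<close> vanishes at \<open>r = w + d / c\<close>, and so do its
  images under \<open>S\<close>. If \<open>r\<close> is in the disc, evaluation at \<open>r\<close> is bounded, so the vanishing passes to the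
  closure, which therefore misses \<open>f1\<close>.
\<close>
lemma generated_eq_only_if:
  assumes eq: "M = h2_generated S (M \<ominus>\<^sub>H S ` M)"
  shows "1 \<le> cmod (w + d / c)"
proof (rule ccontr)
  define r where "r = w + d / c"
  assume "\<not> 1 \<le> cmod (w + d / c)"
  then have r1: "r \<in> ball 0 1" by (simp add: r_def)
  have rw: "(r - w) * c = d" using c by (simp add: r_def)
  \<comment> \<open>V is spanned by f2 and the vectors whose model function vanishes at r.\<close>
  define V where "V = {vec k a h | k a h. d * a + (r - w) * h2_eval h r = 0}"
  have V_I: "vec k a h \<in> V" if "d * a + (r - w) * h2_eval h r = 0" for k a h
    using that unfolding V_def by blast
  have V_E: "\<exists>k a h. x = vec k a h \<and> d * a + (r - w) * h2_eval h r = 0" if "x \<in> V" for x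
    using that unfolding V_def by blast
  have V_add: "x + y \<in> V" if xV: "x \<in> V" and yV: "y \<in> V" for x y
  proof -
    obtain k a h where x: "x = vec k a h" "d * a + (r - w) * h2_eval h r = 0"
      using V_E[OF xV] by blast
    obtain k' a' h' where y: "y = vec k' a' h'" "d * a' + (r - w) * h2_eval h' r = 0"
      using V_E[OF yV] by blast
    have "d * (a + a') + (r - w) * h2_eval (h + h') r
        = (d * a + (r - w) * h2_eval h r) + (d * a' + (r - w) * h2_eval h' r)"
      by (simp add: algebra_simps)
    then show ?thesis unfolding x(1) y(1) vec_add using x y by (intro V_I) simp
  qed
  have V_scale: "h2_scale b x \<in> V" if xV: "x \<in> V" for b x
  proof -
    obtain k a h where x: "x = vec k a h" "d * a + (r - w) * h2_eval h r = 0"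
      using V_E[OF xV] by blast
    have "d * (b * a) + (r - w) * h2_eval (h2_scale b h) r = b * (d * a + (r - w) * h2_eval h r)"
      by (simp add: algebra_simps)
    then show ?thesis unfolding x(1) vec_scale using x by (intro V_I) simp
  qed
  have V_S: "S x \<in> V" if xV: "x \<in> V" for x
  proof -
    obtain k a h where x: "x = vec k a h" "d * a + (r - w) * h2_eval h r = 0"
      using V_E[OF xV] by blast
    have "d * (k + a * w) + (r - w) * (r * h2_eval h r + (a * d - k * c))
        = r * (d * a + (r - w) * h2_eval h r) + k * (d - (r - w) * c)"
      by (simp add: algebra_simps)
    then show ?thesis
      unfolding x(1) S_vec using x r1 rw by (intro V_I) (simp add: h2_eval_monom)
  qed
  have "0 \<in> V" using V_I[of 0 0 0] by (simp add: vec_zero)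
  then have V: "h2.subspace V"
    unfolding h2.subspace_def using V_add V_scale by blast
  have "(S ^^ n) x \<in> V" if "x \<in> M \<ominus>\<^sub>H S ` M" for n x
  proof (induction n)
    case 0
    then show ?case using that by (auto simp: wandering_subspace intro!: V_I)
  qed (simp add: V_S)
  then have "h2.span {(S ^^ n) h | n h. h \<in> M \<ominus>\<^sub>H S ` M} \<subseteq> V"
    by (intro h2.span_minimal V) blast
  then have "M \<subseteq> closure V"
    by (subst eq) (simp add: h2_generated_def closure_mono)
  then have f1_V: "f1 \<in> closure V" using vec_in_M[of 0 1 0] by (auto simp: vec_f1)
  obtain C where C: "\<And>h. cmod (h2_eval h r) \<le> C * norm (h2_mult \<phi> h)"
    using eval_le_norm_mult[OF r1 p] by blast
  define L where "L = 1 / norm f1 + \<bar>C\<bar> / cmod c"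
  have L: "0 < L" using f1 by (simp add: L_def add_pos_nonneg)
  \<comment> \<open>If a is near 1 then c a = - h(r) is not small, and neither is the product of h with the multiplier.\<close>
  have far: "1 \<le> L * norm (y - f1)" if xV: "y \<in> V" for y
  proof -
    obtain k a h where y: "y = vec k a h" "d * a + (r - w) * h2_eval h r = 0"
      using V_E[OF xV] by blast
    have "(r - w) * (c * a + h2_eval h r) = 0"
      using y(2) by (simp add: rw[symmetric] algebra_simps)
    then have "c * a = - h2_eval h r"
      using rw d by (auto simp: add_eq_0_iff)
    then have "cmod c * cmod a = cmod (h2_eval h r)"
      by (metis norm_minus_cancel norm_mult)
    let ?x = "h2_scale (a - 1) f1" and ?t = "h2_mult \<phi> h"
    have split: "y - f1 = h2_scale k f2 + (?x + ?t)"
      by (rule h2_eqI) (simp add: y(1) vec_def algebra_simps)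
    have "norm (?x + ?t) \<le> norm (y - f1)"
      unfolding split
      by (rule norm_le_norm_orthogonal_add(2))
        (simp add: h2_inner_scale_left h2_inner_scale_right h2_inner_add_right orth)
    moreover have "norm ?x \<le> norm (?x + ?t)" "norm ?t \<le> norm (?x + ?t)"
      by (rule norm_le_norm_orthogonal_add; simp add: h2_inner_scale_left orth)+
    ultimately have x: "norm ?x \<le> norm (y - f1)" and t: "norm ?t \<le> norm (y - f1)"
      by linarith+
    have "cmod (a - 1) \<le> norm (y - f1) / norm f1"
      using x f1 by (simp add: pos_le_divide_eq)
    moreover have "cmod a \<le> \<bar>C\<bar> * norm (y - f1) / cmod c"
    proof -
      have "cmod c * cmod a \<le> C * norm ?t"
        using C[of h] \<open>cmod c * cmod a = cmod (h2_eval h r)\<close> by simp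
      also have "\<dots> \<le> \<bar>C\<bar> * norm (y - f1)"
        using t by (intro mult_mono) auto
      finally show ?thesis using c by (simp add: pos_le_divide_eq mult.commute)
    qed
    moreover have "1 \<le> cmod a + cmod (a - 1)"
      using norm_triangle_ineq4[of a "a - 1"] by simp
    ultimately show ?thesis by (simp add: L_def algebra_simps)
  qed
  obtain y where "y \<in> V" "dist y f1 < 1 / L"
    using f1_V L unfolding closure_approachable by (meson zero_less_divide_1_iff)
  then have "L * norm (y - f1) < 1"
    using L by (simp add: dist_norm pos_less_divide_eq mult.commute)
  with far[OF \<open>y \<in> V\<close>] show False by simp
qed

end

section \<open>The compressed shift\<close>

lemma h2_inner_monom: "h2_inner (h2_monom n) h = cnj (h2_coeff h n)"
proof -
  have "h2_inner (h2_monom n) h = (\<Sum>k\<in>{n}. h2_coeff (h2_monom n) k * cnj (h2_coeff h k))"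
    unfolding h2_inner_def by (rule suminf_finite) (auto simp: h2_coeff_monom)
  then show ?thesis by (simp add: h2_coeff_monom)
qed

lemma h2_proj_eqI:
  assumes "h2.subspace A" "g \<in> A" "\<And>h. h \<in> A \<Longrightarrow> h2_inner (f - g) h = 0"
  shows "h2_proj A f = g"
  unfolding h2_proj_def
proof (rule the_equality)
  fix g' assume g': "g' \<in> A \<and> (\<forall>h\<in>A. h2_inner (f - g') h = 0)"
  let ?h = "g' - g"
  have "?h \<in> A" using g' assms(1,2) by (simp add: h2.subspace_diff)
  then have "h2_inner (f - g) ?h = 0" "h2_inner (f - g') ?h = 0"
    using g' assms(3) by auto
  moreover have "h2_inner ?h ?h = h2_inner (f - g) ?h - h2_inner (f - g') ?h"
    by (subst h2_inner_diff_left[symmetric]) (simp add: algebra_simps)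
  ultimately have "h2_inner ?h ?h = 0" by simp
  then show "g' = g" by (simp add: h2_inner_self_norm)
qed (use assms in auto)

lemma h2_coeff_f0: "h2_coeff (f0 \<alpha> \<beta>) n = (if n = 0 then \<alpha> else if n = 1 then \<beta> else 0)"
  by (simp add: f0_def h2_coeff_monom)

text \<open>
  Membership is decided by the first two Taylor coefficients alone: they must be proportional to
  \<open>(\<alpha>, \<beta>)\<close>. The truncations of such a function are combinations of the generators and approximate it.
\<close>
lemma H2sub_iff:
  assumes "\<alpha> \<noteq> 0"
  shows "f \<in> H2sub \<alpha> \<beta> \<longleftrightarrow> \<beta> * h2_coeff f 0 = \<alpha> * h2_coeff f 1"
proof
  let ?A = "{f. \<beta> * h2_coeff f 0 = \<alpha> * h2_coeff f 1}"
  let ?G = "insert (f0 \<alpha> \<beta>) {h2_monom n | n. n \<ge> 2}"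
  have cont: "continuous_on UNIV (\<lambda>f. h2_coeff f n)" for n
    by (rule linear_continuous_on) (rule bounded_linear_h2_coeff)
  have "closed ?A"
    by (intro closed_Collect_eq continuous_on_mult continuous_on_const cont)
  moreover have "h2.subspace ?A"
    unfolding h2.subspace_def by (auto simp: algebra_simps)
  moreover have "?G \<subseteq> ?A" by (auto simp: h2_coeff_f0 h2_coeff_monom)
  ultimately have "H2sub \<alpha> \<beta> \<subseteq> ?A"
    unfolding H2sub_def by (intro closure_minimal h2.span_minimal)
  then show "\<beta> * h2_coeff f 0 = \<alpha> * h2_coeff f 1" if "f \<in> H2sub \<alpha> \<beta>"
    using that by blast
  assume f: "\<beta> * h2_coeff f 0 = \<alpha> * h2_coeff f 1"
  have "h2_poly (N + 2) (h2_coeff f) \<in> h2.span ?G" for N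
  proof (induction N)
    case 0
    have "h2_poly 2 (h2_coeff f) = h2_scale (h2_coeff f 0 / \<alpha>) (f0 \<alpha> \<beta>)"
    proof (intro h2_eqI_coeff ext)
      fix n
      show "h2_coeff (h2_poly 2 (h2_coeff f)) n = h2_coeff (h2_scale (h2_coeff f 0 / \<alpha>) (f0 \<alpha> \<beta>)) n"
        using f assms by (auto simp: h2_coeff_poly h2_coeff_f0 field_simps less_2_cases_iff)
    qed
    also have "\<dots> \<in> h2.span ?G"
      by (intro h2.span_scale h2.span_base) simp
    finally show ?case by (simp add: numeral_2_eq_2)
  next
    case (Suc N)
    have "h2_poly (Suc N + 2) (h2_coeff f)
        = h2_poly (N + 2) (h2_coeff f) + h2_scale (h2_coeff f (N + 2)) (h2_monom (N + 2))"
      by (simp add: h2_poly_def)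
    moreover have "h2_monom (N + 2) \<in> h2.span ?G"
      by (intro h2.span_base) auto
    ultimately show ?case
      using Suc by (simp add: h2.span_add h2.span_scale)
  qed
  moreover have "(\<lambda>N. h2_poly (N + 2) (h2_coeff f)) \<longlonglongrightarrow> f"
    by (intro LIMSEQ_ignore_initial_segment h2_poly_tendsto)
  ultimately show "f \<in> H2sub \<alpha> \<beta>"
    unfolding H2sub_def closure_sequential
    by (intro exI[of _ "\<lambda>N. h2_poly (N + 2) (h2_coeff f)"]) blast
qed

lemma subspace_H2sub: "h2.subspace (H2sub \<alpha> \<beta>)"
  unfolding H2sub_def by (intro h2_subspace_closure h2.subspace_span)

text \<open>
  The complement of \<open>H2sub \<alpha> \<beta>\<close> consists of the multiples of \<open>cnj \<beta> - cnj \<alpha> z\<close>, so the compression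
  changes only the first two Taylor coefficients of \<open>z f\<close>. The correction multiplies the pair
  \<open>(f\<^sub>0, f\<^sub>1)\<close> by \<open>\<alpha> cnj \<beta>\<close>, which keeps it proportional to \<open>(\<alpha>, \<beta>)\<close>.
\<close>
lemma S_op_eq:
  assumes \<alpha>: "\<alpha> \<noteq> 0" and norm: "(cmod \<alpha>)\<^sup>2 + (cmod \<beta>)\<^sup>2 = 1" and f: "f \<in> H2sub \<alpha> \<beta>"
  shows "S_op \<alpha> \<beta> f = h2_shift f + h2_scale (\<alpha> * cnj \<beta> * h2_coeff f 0) (h2_monom 0)
           + h2_scale (\<alpha> * cnj \<beta> * h2_coeff f 1 - h2_coeff f 0) (h2_monom 1)"
proof -
  let ?w = "\<alpha> * cnj \<beta>"
  let ?p = "h2_scale (?w * h2_coeff f 0) (h2_monom 0)"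
  let ?q = "h2_scale (?w * h2_coeff f 1 - h2_coeff f 0) (h2_monom 1)"
  have unit: "\<alpha> * cnj \<alpha> + \<beta> * cnj \<beta> = 1"
    using norm by (metis complex_norm_square of_real_1 of_real_add)
  have f01: "\<beta> * h2_coeff f 0 = \<alpha> * h2_coeff f 1"
    using f H2sub_iff[OF \<alpha>] by blast
  show ?thesis
    unfolding S_op_def
  proof (rule h2_proj_eqI[OF subspace_H2sub])
    show "h2_shift f + ?p + ?q \<in> H2sub \<alpha> \<beta>"
      using f01 by (simp add: H2sub_iff[OF \<alpha>] h2_coeff_shift h2_coeff_monom algebra_simps)
  next
    fix h assume "h \<in> H2sub \<alpha> \<beta>"
    then have h01: "\<beta> * h2_coeff h 0 = \<alpha> * h2_coeff h 1"
      using H2sub_iff[OF \<alpha>] by blast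
    let ?f = "h2_coeff f" and ?h = "\<lambda>n. cnj (h2_coeff h n)"
    have h01': "cnj \<beta> * ?h 0 = cnj \<alpha> * ?h 1"
      using h01 by (metis complex_cnj_mult)
    have "?f 0 - ?w * ?f 1 = ?f 0 - cnj \<beta> * (\<alpha> * ?f 1)" by (simp add: mult_ac)
    also have "\<dots> = ?f 0 * (1 - \<beta> * cnj \<beta>)" unfolding f01[symmetric] by (simp add: algebra_simps)
    also have "1 - \<beta> * cnj \<beta> = \<alpha> * cnj \<alpha>" using unit by (simp add: algebra_simps)
    finally have f1: "?f 0 - ?w * ?f 1 = ?f 0 * (\<alpha> * cnj \<alpha>)" .
    have "h2_shift f - (h2_shift f + ?p + ?q)
        = h2_scale (- (?w * ?f 0)) (h2_monom 0) + h2_scale (?f 0 - ?w * ?f 1) (h2_monom 1)"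
      by (rule h2_eqI) (simp add: algebra_simps)
    then have "h2_inner (h2_shift f - (h2_shift f + ?p + ?q)) h
        = - (?w * ?f 0) * ?h 0 + (?f 0 - ?w * ?f 1) * ?h 1"
      by (simp only: h2_inner_add_left h2_inner_scale_left h2_inner_monom)
    also have "\<dots> = \<alpha> * ?f 0 * (cnj \<alpha> * ?h 1 - cnj \<beta> * ?h 0)"
      unfolding f1 by (simp add: algebra_simps)
    finally show "h2_inner (h2_shift f - (h2_shift f + ?p + ?q)) h = 0"
      unfolding h01' by simp
  qed
qed

lemma mem_h2_span_singleton: "x \<in> h2.span {y} \<longleftrightarrow> (\<exists>k. x = h2_scale k y)"
  by (auto simp: h2.span_singleton)

theorem theorem5p4:
  fixes \<alpha> \<beta> w r :: complex
    and M :: "h2 set"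
    and \<theta> :: "complex \<Rightarrow> complex"
    and g f1 f2 :: h2
  assumes "\<alpha> \<noteq> 0" and "\<beta> \<noteq> 0" and "(cmod \<alpha>)\<^sup>2 + (cmod \<beta>)\<^sup>2 = 1"
    and w_def: "w = \<alpha> * cnj \<beta>"
    and "h2.subspace M" and "closed M" and "M \<noteq> {0}" and "M \<subset> H2sub \<alpha> \<beta>"
    and "S_op \<alpha> \<beta> ` M \<subseteq> M"
    and "inner_function \<theta>" and "\<theta> w \<noteq> 0"
    and "g \<in> UNIV \<ominus>\<^sub>H h2_mult_range \<theta>"
    and "\<forall>z\<in>ball 0 1. (z - w) * h2_eval g z = \<beta> / \<theta> w * (\<theta> z - \<theta> w)"
    and "\<forall>z\<in>ball 0 1. h2_eval f1 z = w * h2_eval (f0 \<alpha> \<beta>) z + \<beta> * z ^ 2 + z ^ 3 * h2_eval g z"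
    and "\<forall>z\<in>ball 0 1. h2_eval f2 z = h2_eval (f0 \<alpha> \<beta>) z + z ^ 2 * h2_eval g z
           - cnj \<alpha> * \<beta> / cnj \<beta> * cnj (\<theta> w) * of_real (1 + (norm g)\<^sup>2) * z ^ 2 * \<theta> z"
    and "is_orthogonal_sum3 M (h2.span {f2}) (h2.span {f1}) (h2_mult_range (\<lambda>z. z ^ 3 * \<theta> z))"
    and r_def: "r = w * of_real (1 + (cmod \<alpha>)\<^sup>2 * (cmod (\<theta> w))\<^sup>2 * (1 + (norm g)\<^sup>2))
                  / of_real ((cmod \<alpha>)\<^sup>2 * (cmod (\<theta> w))\<^sup>2 * (1 + (norm g)\<^sup>2))"
  shows "M = h2_generated (S_op \<alpha> \<beta>) (M \<ominus>\<^sub>H (S_op \<alpha> \<beta> ` M)) \<longleftrightarrow> cmod r \<ge> 1"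
proof -
  note \<alpha> = assms(1) and \<beta> = assms(2) and unit = assms(3)
  define G where "G = 1 + (norm g)\<^sup>2"
  define c where "c = cnj \<alpha> * \<beta> / cnj \<beta> * cnj (\<theta> w) * of_real G"
  define d where "d = \<beta> / \<theta> w"
  define \<phi> where "\<phi> z = z ^ 3 * \<theta> z" for z
  define T where "T = (cmod \<alpha>)\<^sup>2 * (cmod (\<theta> w))\<^sup>2 * G"
  have G: "0 < G" unfolding G_def by (rule add_pos_nonneg) auto
  have T: "0 < T" using G \<alpha> \<open>\<theta> w \<noteq> 0\<close> by (simp add: T_def)
  have c: "c \<noteq> 0" and d: "d \<noteq> 0"
    using \<alpha> \<beta> \<open>\<theta> w \<noteq> 0\<close> G by (simp_all add: c_def d_def)
  \<comment> \<open>The factor T is the positive number in the denominator of r; it gives both d + w c = (1 + T) d and r = w + d / c.\<close>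
  have wc: "w * c = d * of_real T"
  proof -
    have "w * c = \<beta> * (\<alpha> * cnj \<alpha>) * cnj (\<theta> w) * of_real G"
      using \<beta> by (simp add: w_def c_def field_simps)
    also have "\<dots> = d * ((\<alpha> * cnj \<alpha>) * (\<theta> w * cnj (\<theta> w)) * of_real G)"
      using \<open>\<theta> w \<noteq> 0\<close> by (simp add: d_def)
    also have "\<dots> = d * of_real T"
      unfolding T_def of_real_mult complex_norm_square ..
    finally show ?thesis .
  qed
  have det: "d + w * c \<noteq> 0"
  proof -
    have "d + w * c = d * of_real (1 + T)" by (simp add: wc distrib_left)
    moreover have "of_real (1 + T) \<noteq> (0::complex)"
      using T by (subst of_real_eq_0_iff) simp
    ultimately show ?thesis using d by simp
  qed
  have r_eq: "r = w + d / c"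
  proof -
    have "w = d / c * of_real T" using wc c by (simp add: field_simps)
    moreover have "r = w * of_real (1 + T) / of_real T"
      by (simp add: r_def T_def G_def mult.assoc)
    moreover have "\<dots> = w + w / of_real T" using T by (simp add: field_simps)
    ultimately show ?thesis using T by simp
  qed
  have w1: "cmod w < 1" and w0: "w \<noteq> 0"
  proof -
    have "2 * (cmod \<alpha> * cmod \<beta>) \<le> 1"
      using zero_le_power2[of "cmod \<alpha> - cmod \<beta>"] unit unfolding power2_diff by simp
    then show "cmod w < 1" by (simp add: w_def norm_mult)
    show "w \<noteq> 0" using \<alpha> \<beta> by (simp add: w_def)
  qed
  have "\<theta> holomorphic_on ball 0 1" "bounded (\<theta> ` ball 0 1)"
    using \<open>inner_function \<theta>\<close> unfolding inner_function_def by blast+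
  then obtain B where B: "\<And>z. z \<in> ball 0 1 \<Longrightarrow> cmod (\<theta> z) \<le> B"
    unfolding bounded_iff by blast
  interpret bounded_multiplier \<phi> B
  proof
    show "\<phi> holomorphic_on ball 0 1"
      unfolding \<phi>_def by (intro holomorphic_intros \<open>\<theta> holomorphic_on ball 0 1\<close>)
    show "cmod (\<phi> z) \<le> B" if z: "z \<in> ball 0 1" for z
    proof -
      have "cmod z ^ 3 * cmod (\<theta> z) \<le> 1 * B"
        using z by (intro mult_mono B power_le_one) auto
      then show ?thesis by (simp add: \<phi>_def norm_mult norm_power)
    qed
  qed
  have M: "M = {h2_scale k f2 + h2_scale a f1 + h2_mult \<phi> h | k a h. True}"
    and orth: "h2_inner f2 f1 = 0" "\<And>h. h2_inner f2 (h2_mult \<phi> h) = 0"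
      "\<And>h. h2_inner f1 (h2_mult \<phi> h) = 0"
  proof -
    have *: "is_orthogonal_sum3 M (h2.span {f2}) (h2.span {f1}) (range (h2_mult \<phi>))"
      using assms(16) unfolding mult_range_eq[symmetric] \<phi>_def .
    then have "M = {a + b + c | a b c. a \<in> h2.span {f2} \<and> b \<in> h2.span {f1} \<and> c \<in> range (h2_mult \<phi>)}"
      unfolding is_orthogonal_sum3_def by blast
    then show "M = {h2_scale k f2 + h2_scale a f1 + h2_mult \<phi> h | k a h. True}"
      by (auto simp: mem_h2_span_singleton) blast
    show "h2_inner f2 f1 = 0" "\<And>h. h2_inner f2 (h2_mult \<phi> h) = 0"
      "\<And>h. h2_inner f1 (h2_mult \<phi> h) = 0"
      using * h2.span_base[of f1 "{f1}"] h2.span_base[of f2 "{f2}"]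
      unfolding is_orthogonal_sum3_def h2_orthogonal_def by blast+
  qed
  have f0_eval: "h2_eval (f0 \<alpha> \<beta>) z = \<alpha> + \<beta> * z" if "z \<in> ball 0 1" for z
    using that by (simp add: f0_def h2_eval_monom)
  \<comment> \<open>Vectors a f0 + z^2 h; on this normal form the compressed shift is S (F a h) = F (a w) (z h + a beta).\<close>
  define F where "F a = (\<lambda>h. h2_scale a (f0 \<alpha> \<beta>) + h2_shift (h2_shift h))" for a
  have F_sub: "F a h \<in> H2sub \<alpha> \<beta>" for a h
    by (simp add: H2sub_iff[OF \<alpha>] F_def h2_coeff_f0 h2_coeff_shift)
  have S_F: "S_op \<alpha> \<beta> (F a h) = F (a * w) (h2_shift h + h2_scale (a * \<beta>) (h2_monom 0))" for a h
  proof (rule h2_eqI)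
    fix z :: complex assume z: "z \<in> ball 0 1"
    have co: "h2_coeff (F a h) 0 = a * \<alpha>" "h2_coeff (F a h) 1 = a * \<beta>"
      by (simp_all add: F_def h2_coeff_f0 h2_coeff_shift)
    show "h2_eval (S_op \<alpha> \<beta> (F a h)) z = h2_eval (F (a * w) (h2_shift h + h2_scale (a * \<beta>) (h2_monom 0))) z"
      unfolding S_op_eq[OF \<alpha> unit F_sub] co w_def[symmetric]
      using z by (simp add: F_def f0_eval h2_eval_monom algebra_simps)
  qed
  interpret \<theta>: bounded_multiplier \<theta> B
    using \<open>\<theta> holomorphic_on ball 0 1\<close> B by unfold_locales
  define q1 where "q1 = h2_scale \<beta> (h2_monom 0) + h2_shift g"
  define q2 where "q2 = g - h2_scale c (h2_mult \<theta> (h2_monom 0))"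
  have f1_F: "f1 = F w q1"
    by (rule h2_eqI) (use assms(14) in \<open>simp add: F_def q1_def h2_eval_monom
        distrib_left power3_eq_cube power2_eq_square mult_ac\<close>)
  have f2_F: "f2 = F 1 q2"
  proof (rule h2_eqI)
    fix z :: complex assume z: "z \<in> ball 0 1"
    then have "h2_eval f2 z = h2_eval (f0 \<alpha> \<beta>) z + z ^ 2 * h2_eval g z - c * z ^ 2 * \<theta> z"
      using assms(15) unfolding c_def G_def by blast
    then show "h2_eval f2 z = h2_eval (F 1 q2) z"
      using z by (simp add: F_def q2_def h2_eval_monom right_diff_distrib power2_eq_square mult_ac)
  qed
  have mult_F: "h2_mult \<phi> h = F 0 (h2_shift (h2_mult \<theta> h))" for h
    by (rule h2_eqI) (simp add: F_def \<phi>_def power3_eq_cube mult_ac)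
  have F_cong: "F a h = F a' h'" if "a = a'" "h = h'" for a a' h h'
    using that by simp
  have F_add: "F a h + F a' h' = F (a + a') (h + h')" for a a' h h'
    by (rule h2_eqI) (simp add: F_def algebra_simps)
  have F_scale: "h2_scale b (F a h) = F (b * a) (h2_scale b h)" for a b h
    by (rule h2_eqI) (simp add: F_def algebra_simps)
  have S: "S_op \<alpha> \<beta> (h2_scale k f2 + h2_scale a f1 + h2_mult \<phi> h)
      = h2_scale (k + a * w) f1 + h2_mult \<phi> (h2_shift h + h2_scale (a * d - k * c) (h2_monom 0))"
    for k a h
    unfolding f1_F f2_F mult_F F_add F_scale S_F
  proof (rule F_cong)
    show "(k * 1 + a * w + 0) * w = (k + a * w) * w + 0" by simp
    show "h2_shift (h2_scale k q2 + h2_scale a q1 + h2_shift (h2_mult \<theta> h))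
          + h2_scale ((k * 1 + a * w + 0) * \<beta>) (h2_monom 0)
        = h2_scale (k + a * w) q1
          + h2_shift (h2_mult \<theta> (h2_shift h + h2_scale (a * d - k * c) (h2_monom 0)))"
    proof (rule h2_eqI)
      fix z :: complex assume z: "z \<in> ball 0 1"
      have "(z - w) * h2_eval g z = d * \<theta> z - \<beta>"
        using assms(13) z \<open>\<theta> w \<noteq> 0\<close> by (simp add: d_def right_diff_distrib)
      then have *: "a * z * (\<beta> + (z - w) * h2_eval g z - d * \<theta> z) = 0" by simp
      \<comment> \<open>The two sides differ by a multiple of the equation defining g.\<close>
      have "z * (k * (h2_eval g z - c * \<theta> z) + a * (\<beta> + z * h2_eval g z) + z * (\<theta> z * h2_eval h z))
            + (k + a * w) * \<beta>
          = (k + a * w) * (\<beta> + z * h2_eval g z) + z * (\<theta> z * (z * h2_eval h z + (a * d - k * c)))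
            + a * z * (\<beta> + (z - w) * h2_eval g z - d * \<theta> z)"
        by (simp add: algebra_simps)
      then show "h2_eval (h2_shift (h2_scale k q2 + h2_scale a q1 + h2_shift (h2_mult \<theta> h))
          + h2_scale ((k * 1 + a * w + 0) * \<beta>) (h2_monom 0)) z
        = h2_eval (h2_scale (k + a * w) q1
          + h2_shift (h2_mult \<theta> (h2_shift h + h2_scale (a * d - k * c) (h2_monom 0)))) z"
        unfolding * using z by (simp add: q1_def q2_def h2_eval_monom)
    qed
  qed
  interpret extended_shift \<phi> B "S_op \<alpha> \<beta>" f1 f2 w c d w M
  proof
    show "f1 \<noteq> 0"
    proof
      assume "f1 = 0"
      then have "h2_coeff (F w q1) 0 = 0" by (simp flip: f1_F)
      then show False using w0 \<alpha> by (simp add: F_def h2_coeff_f0 h2_coeff_shift)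
    qed
    show "w \<in> ball 0 1" "\<phi> w \<noteq> 0"
      using w1 w0 \<open>\<theta> w \<noteq> 0\<close> by (simp_all add: \<phi>_def)
  qed (fact M \<open>closed M\<close> S orth w1 c d det)+
  show ?thesis
    using generated_eq_if generated_eq_only_if unfolding r_eq by blast
qed

end
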